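(* Let $\mathcal X$ be a separable, complete metric space, and let $K:\mathcal X\times\mathcal X\to\mathbb R$ be a continuous, symmetric, positive semidefinite kernel such that the map $x\mapsto K(\cdot,x)$ is injective. Let $\delta(x,y)=K(x,x)+K(y,y)-2K(x,y)$. Then $\delta^{1/2}(x,y)$ is a metric of strong negative type on $\mathcal X$.
   Context: $K$ is positive semidefinite if for every finite tuple $x_1,\ldots,x_n$ of points of $\mathcal X$ the matrix $(K(x_i,x_j))_{1\le i,j\le n}$ is positive semidefinite. A metric $\rho$ on $\mathcal X$ has negative type if $$\mathfrak D_\rho(G_1,G_2)=\iint\rho(x,y)\,d(G_1-G_2)(x)\,d(G_1-G_2)(y)\le0$$ for all Borel probability measures $G_1,G_2$ on $\mathcal X$ with finite first moment with respect to $\rho$ (i.e. $\int\rho(x,o)\,dG_i(x)<\infty$ for some $o\in\mathcal X$). It has strong negative type if, in addition, equality holds if and only if $G_1=G_2$. *)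

theory Defs
  imports "HOL-Probability.Probability"
begin

definition psd_matrix :: "nat \<Rightarrow> (nat \<Rightarrow> nat \<Rightarrow> real) \<Rightarrow> bool" where
  "psd_matrix n A \<longleftrightarrow>
     (\<forall>i<n. \<forall>j<n. A i j = A j i) \<and>
     (\<forall>c. 0 \<le> (\<Sum>i<n. \<Sum>j<n. c i * A i j * c j))"

definition psd_kernel :: "('a \<Rightarrow> 'a \<Rightarrow> real) \<Rightarrow> bool" where
  "psd_kernel K \<longleftrightarrow> (\<forall>n x. psd_matrix n (\<lambda>i j. K (x i) (x j)))"

definition kernel_delta :: "('a \<Rightarrow> 'a \<Rightarrow> real) \<Rightarrow> 'a \<Rightarrow> 'a \<Rightarrow> real" where
  "kernel_delta K x y = K x x + K y y - 2 * K x y"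

definition borel_prob :: "'a::topological_space measure \<Rightarrow> bool" where
  "borel_prob G \<longleftrightarrow> prob_space G \<and> sets G = sets borel"

definition finite_first_moment :: "('a \<Rightarrow> 'a \<Rightarrow> real) \<Rightarrow> 'a measure \<Rightarrow> bool" where
  "finite_first_moment \<rho> G \<longleftrightarrow> (\<exists>p. integrable G (\<lambda>x. \<rho> x p))"

text \<open>
  The integral of \<open>f\<close> against the signed measure \<open>G\<^sub>1 - G\<^sub>2\<close>.
\<close>

definition diff_integral :: "'a measure \<Rightarrow> 'a measure \<Rightarrow> ('a \<Rightarrow> real) \<Rightarrow> real" where
  "diff_integral G1 G2 f = (\<integral>x. f x \<partial>G1) - (\<integral>x. f x \<partial>G2)"

text \<open>
  For a Borel measurable metric \<open>\<rho>\<close> and measures with finite first moment, the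
  triangle inequality makes all the integrals below converge absolutely, so the
  convention that a non-integrable function has Bochner integral 0 plays no role.
\<close>

definition metric_discrepancy ::
    "('a \<Rightarrow> 'a \<Rightarrow> real) \<Rightarrow> 'a measure \<Rightarrow> 'a measure \<Rightarrow> real" where
  "metric_discrepancy \<rho> G1 G2 =
     diff_integral G1 G2 (\<lambda>x. diff_integral G1 G2 (\<lambda>y. \<rho> x y))"

text \<open>
  The Borel sets are those of the topology that the type \<open>'a\<close> carries, which need not
  be the topology induced by \<open>\<rho>\<close>.
\<close>

definition negative_type :: "('a::topological_space \<Rightarrow> 'a \<Rightarrow> real) \<Rightarrow> bool" where
  "negative_type \<rho> \<longleftrightarrow>
     (\<forall>G1 G2. borel_prob G1 \<and> borel_prob G2 \<and>
        finite_first_moment \<rho> G1 \<and> finite_first_moment \<rho> G2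
        \<longrightarrow> metric_discrepancy \<rho> G1 G2 \<le> 0)"

definition strong_negative_type :: "('a::topological_space \<Rightarrow> 'a \<Rightarrow> real) \<Rightarrow> bool" where
  "strong_negative_type \<rho> \<longleftrightarrow>
     negative_type \<rho> \<and>
     (\<forall>G1 G2. borel_prob G1 \<and> borel_prob G2 \<and>
        finite_first_moment \<rho> G1 \<and> finite_first_moment \<rho> G2
        \<longrightarrow> (metric_discrepancy \<rho> G1 G2 = 0 \<longleftrightarrow> G1 = G2))"

end

theory Submission imports Defs begin

text \<open>
  Write \<open>\<mu> = G - H\<close> and \<open>\<rho> = \<delta>\<^sup>1\<^sup>/\<^sup>2\<close>. Since \<open>C s = \<integral> (1 - exp (- u\<^sup>2 s\<^sup>2)) / u\<^sup>2 du\<close> for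
  \<open>s \<ge> 0\<close>, Fubini turns the discrepancy of \<open>\<rho>\<close> into minus an integral over \<open>u\<close> of the energies
  \<open>E u = \<integral>\<integral> exp (- u\<^sup>2 \<delta>) d\<mu> d\<mu>\<close>, which are nonnegative because Gaussian kernels are positive
  semidefinite (Schur product theorem). If the discrepancy vanishes, then \<open>E u = 0\<close> for all \<open>u\<close> by
  continuity, and a Cauchy--Schwarz argument gives \<open>\<integral> exp (- t K x x + w x) d\<mu>(x) = 0\<close> for all
  \<open>t > 0\<close> and all \<open>w\<close> in the reproducing kernel Hilbert space of \<open>K\<close>. These functions are closed
  under products and separate points, so Stone--Weierstrass together with tightness yields \<open>G = H\<close>.
\<close>

section \<open>Positive semidefinite matrices\<close>

text \<open>Exchanging the sums turns the form into a sum over \<open>k\<close> of the squares of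
  \<open>\<Sum>i<n. c i * L k i\<close>.\<close>

lemma psd_matrix_gramI:
  assumes "\<And>i j. i < n \<Longrightarrow> j < n \<Longrightarrow> A i j = (\<Sum>k<m. L k i * L k j)"
  shows "psd_matrix n A"
proof -
  have "(\<Sum>i<n. \<Sum>j<n. c i * A i j * c j) = (\<Sum>k<m. (\<Sum>i<n. c i * L k i)\<^sup>2)" for c :: "nat \<Rightarrow> real"
  proof -
    have "(\<Sum>i<n. \<Sum>j<n. c i * A i j * c j)
        = (\<Sum>i<n. \<Sum>j<n. \<Sum>k<m. (c i * L k i) * (c j * L k j))"
      by (intro sum.cong refl) (simp add: assms sum_distrib_left sum_distrib_right algebra_simps)
    also have "\<dots> = (\<Sum>i<n. \<Sum>k<m. \<Sum>j<n. (c i * L k i) * (c j * L k j))"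
      by (intro sum.cong refl sum.swap)
    also have "\<dots> = (\<Sum>k<m. \<Sum>i<n. \<Sum>j<n. (c i * L k i) * (c j * L k j))"
      by (rule sum.swap)
    also have "\<dots> = (\<Sum>k<m. (\<Sum>i<n. c i * L k i)\<^sup>2)"
      by (simp add: power2_eq_square sum_product)
    finally show ?thesis .
  qed
  then show ?thesis
    unfolding psd_matrix_def by (auto simp: assms mult.commute intro!: sum_nonneg)
qed

section \<open>Bordered quadratic forms and the discriminant criterion\<close>

lemma sum_sum_lessThan_Suc:
  fixes f :: "nat \<Rightarrow> nat \<Rightarrow> real"
  shows "(\<Sum>i<Suc n. \<Sum>j<Suc n. f i j)
       = (\<Sum>i<n. \<Sum>j<n. f i j) + (\<Sum>i<n. f i n) + (\<Sum>j<n. f n j) + f n n"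
  by (simp add: sum.distrib)

lemma sum_sum_bordered:
  fixes A :: "nat \<Rightarrow> nat \<Rightarrow> real"
  assumes "\<And>i. i < n \<Longrightarrow> A n i = A i n"
  shows "(\<Sum>i<Suc n. \<Sum>j<Suc n. c i * A i j * c j)
       = (\<Sum>i<n. \<Sum>j<n. c i * A i j * c j) + 2 * c n * (\<Sum>i<n. c i * A i n) + (c n)\<^sup>2 * A n n"
proof -
  have "(\<Sum>i<n. c i * A i n * c n) = c n * (\<Sum>i<n. c i * A i n)"
    by (simp add: sum_distrib_left mult_ac)
  moreover have "(\<Sum>i<n. c n * A n i * c i) = c n * (\<Sum>i<n. c i * A i n)"
    using assms by (simp add: sum_distrib_left mult_ac)
  ultimately show ?thesis
    unfolding sum_sum_lessThan_Suc by (simp add: power2_eq_square)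
qed

text \<open>The discriminant criterion, with the degenerate case \<open>r = 0\<close> included and
  the sign of \<open>r\<close> derived. Every Cauchy--Schwarz inequality below comes from it, with
  \<open>b\<close> the weight of one adjoined vector.\<close>

lemma quadratic_nonneg_imp_le:
  fixes p q r :: real
  assumes "\<And>b. 0 \<le> p + 2 * b * q + b\<^sup>2 * r"
  shows "q\<^sup>2 \<le> p * r"
proof (cases "r = 0")
  case True
  show ?thesis
  proof (rule ccontr)
    assume "\<not> ?thesis"
    then have "q \<noteq> 0" using True by auto
    then show False
      \<comment> \<open>This \<open>b\<close> makes the affine expression
        \<open>p + 2 * b * q\<close> equal to -1.\<close>
      using assms[of "- (p + 1) / (2 * q)"] True by (simp add: field_simps)
  qed
next
  case False
  have "r \<ge> 0"
  proof (rule ccontr)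
    assume neg: "\<not> r \<ge> 0"
    \<comment> \<open>Large enough that \<open>b * (- r)\<close> exceeds
      \<open>\<bar>p\<bar> + 2 * \<bar>q\<bar> + 1\<close>; after multiplication by \<open>b\<close>
      the square term dominates and the quadratic is at most \<open>- b\<close>.\<close>
    define b where "b = (\<bar>p\<bar> + 2 * \<bar>q\<bar> + 1) / (- r) + 1"
    have b1: "b \<ge> 1" using neg by (simp add: b_def divide_nonneg_neg)
    have "b * (- r) \<ge> \<bar>p\<bar> + 2 * \<bar>q\<bar> + 1" using neg by (simp add: b_def field_simps)
    then have "b * (b * (- r)) \<ge> b * (\<bar>p\<bar> + 2 * \<bar>q\<bar> + 1)"
      by (rule mult_left_mono) (use b1 in simp)
    moreover have "b * \<bar>p\<bar> \<ge> p" using b1 by (smt (verit) mult_le_cancel_right1 mult.commute)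
    moreover have "b * \<bar>q\<bar> \<ge> b * q" using b1 by (simp add: mult_left_mono)
    moreover have "b * (\<bar>p\<bar> + 2 * \<bar>q\<bar> + 1) = b * \<bar>p\<bar> + 2 * (b * \<bar>q\<bar>) + b"
      by (simp add: algebra_simps)
    moreover have "p + 2 * b * q + b\<^sup>2 * r = p + 2 * (b * q) - b * (b * (- r))"
      by (simp add: power2_eq_square)
    ultimately have "p + 2 * b * q + b\<^sup>2 * r < 0"
      using b1 by linarith
    then show False using assms[of b] by simp
  qed
  then have r: "r > 0" using False by simp
  \<comment> \<open>The minimum of the parabola is attained at \<open>b = - q / r\<close>.\<close>
  have "0 \<le> p + 2 * (- q / r) * q + (- q / r)\<^sup>2 * r" by (rule assms)
  also have "\<dots> = (p * r - q\<^sup>2) / r" using r by (simp add: field_simps power2_eq_square)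
  finally show ?thesis using r by (simp add: zero_le_divide_iff)
qed

text \<open>By the inequality of arithmetic and geometric means,
  \<open>2 * \<bar>b * q\<bar>\<close> is at most the sum of \<open>p\<close> and
  \<open>b\<^sup>2 * r\<close>.\<close>

lemma quadratic_nonnegI:
  fixes p q r :: real
  assumes "q\<^sup>2 \<le> r * p" "0 \<le> p" "0 \<le> r"
  shows "0 \<le> p + 2 * b * q + b\<^sup>2 * r"
proof -
  have "\<bar>b * q\<bar> = sqrt ((b * q)\<^sup>2)" by simp
  also have "\<dots> \<le> sqrt ((b\<^sup>2 * r) * p)"
    using mult_left_mono[OF assms(1), of "b\<^sup>2"] by (intro real_sqrt_le_mono) (simp add: power_mult_distrib mult.assoc)
  also have "\<dots> \<le> ((b\<^sup>2 * r) + p) / 2"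
    using assms by (intro arith_geo_mean_sqrt) auto
  finally show ?thesis by (simp add: abs_le_iff algebra_simps)
qed

lemma psd_matrixD: "psd_matrix n A \<Longrightarrow> 0 \<le> (\<Sum>i<n. \<Sum>j<n. c i * A i j * c j)"
  and psd_matrix_symD: "psd_matrix n A \<Longrightarrow> i < n \<Longrightarrow> j < n \<Longrightarrow> A i j = A j i"
  unfolding psd_matrix_def by auto

text \<open>Cholesky decomposition: split off the last row and pass to the Schur complement.\<close>

lemma psd_matrix_gram:
  assumes "psd_matrix n A"
  obtains L where "\<And>i j. i < n \<Longrightarrow> j < n \<Longrightarrow> A i j = (\<Sum>k<n. L k i * L k j)"
proof -
  have "\<exists>L. \<forall>i<n. \<forall>j<n. A i j = (\<Sum>k<n. L k i * L k j)"
    using assms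
  proof (induction n arbitrary: A)
    case 0
    then show ?case by simp
  next
    case (Suc n)
    define a where "a = A n n"
    note sym = psd_matrix_symD[OF Suc.prems]
    have bord: "0 \<le> (\<Sum>i<n. \<Sum>j<n. c i * A i j * c j) + 2 * b * (\<Sum>i<n. c i * A i n) + b\<^sup>2 * a" for c b
    proof -
      define c' where "c' = c(n := b)"
      have "0 \<le> (\<Sum>i<Suc n. \<Sum>j<Suc n. c' i * A i j * c' j)"
        by (rule psd_matrixD[OF Suc.prems])
      also have "\<dots> = (\<Sum>i<n. \<Sum>j<n. c' i * A i j * c' j) + 2 * c' n * (\<Sum>i<n. c' i * A i n) + (c' n)\<^sup>2 * A n n"
        by (rule sum_sum_bordered) (simp add: sym)
      also have "\<dots> = (\<Sum>i<n. \<Sum>j<n. c i * A i j * c j) + 2 * b * (\<Sum>i<n. c i * A i n) + b\<^sup>2 * a"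
        by (simp add: c'_def a_def)
      finally show ?thesis .
    qed
    have schur: "(\<Sum>i<n. c i * A i n)\<^sup>2 \<le> (\<Sum>i<n. \<Sum>j<n. c i * A i j * c j) * a" for c
      by (rule quadratic_nonneg_imp_le) (rule bord)
    have a0: "a \<ge> 0" using bord[of "\<lambda>_. 0" 1] by simp
    \<comment> \<open>Testing with a unit vector shows that a vanishing corner forces the whole last
      column to vanish.\<close>
    have zero: "A i n = 0" if "a = 0" "i < n" for i
      using schur[of "\<lambda>k. if k = i then 1 else 0"] that
      by (simp add: if_distrib[of "\<lambda>x. x * _"] cong: if_cong)
    \<comment> \<open>For \<open>a = 0\<close> division by zero gives \<open>r i = 0\<close>, which
      is then the correct column, so the singular case needs no separate factorization.\<close>
    define r where "r i = A i n / sqrt a" for i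
    have rr: "r i * r j = A i n * A j n / a" for i j
      using a0 by (simp add: r_def flip: real_sqrt_mult)
    define B where "B i j = A i j - r i * r j" for i j
    have "psd_matrix n B"
      unfolding psd_matrix_def
    proof (intro conjI allI impI)
      show "B i j = B j i" if "i < n" "j < n" for i j
        using sym[of i j] that by (simp add: B_def)
      fix c :: "nat \<Rightarrow> real"
      have "(\<Sum>i<n. \<Sum>j<n. c i * B i j * c j)
          = (\<Sum>i<n. \<Sum>j<n. c i * A i j * c j) - (\<Sum>i<n. \<Sum>j<n. (c i * r i) * (c j * r j))"
        by (simp add: B_def algebra_simps sum_subtractf)
      also have "(\<Sum>i<n. \<Sum>j<n. (c i * r i) * (c j * r j)) = (\<Sum>i<n. c i * r i)\<^sup>2"
        by (simp add: power2_eq_square sum_product)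
      also have "(\<Sum>i<n. c i * r i) = (\<Sum>i<n. c i * A i n) / sqrt a"
        by (simp add: r_def sum_divide_distrib)
      also have "((\<Sum>i<n. c i * A i n) / sqrt a)\<^sup>2 = (\<Sum>i<n. c i * A i n)\<^sup>2 / a"
        using a0 by (simp add: power_divide)
      finally have "(\<Sum>i<n. \<Sum>j<n. c i * B i j * c j)
          = (\<Sum>i<n. \<Sum>j<n. c i * A i j * c j) - (\<Sum>i<n. c i * A i n)\<^sup>2 / a" .
      moreover have "(\<Sum>i<n. c i * A i n)\<^sup>2 / a \<le> (\<Sum>i<n. \<Sum>j<n. c i * A i j * c j)"
        using schur[of c] a0 bord[of c 0] by (cases "a = 0") (simp_all add: pos_divide_le_eq)
      ultimately show "0 \<le> (\<Sum>i<n. \<Sum>j<n. c i * B i j * c j)"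
        by simp
    qed
    from Suc.IH[OF this] obtain L where L: "\<And>i j. i < n \<Longrightarrow> j < n \<Longrightarrow> B i j = (\<Sum>k<n. L k i * L k j)"
      by blast
    \<comment> \<open>The new coordinate \<open>n\<close> holds the column \<open>r\<close>; the
      vector with index \<open>n\<close> has no other coordinate.\<close>
    define L' where "L' k i = (if k = n then r i else if i = n then 0 else L k i)" for k i
    have "A i j = (\<Sum>k<Suc n. L' k i * L' k j)" if "i < Suc n" "j < Suc n" for i j
    proof -
      have "A i j = r i * r j" if "i = n \<or> j = n"
        using that zero sym[of i j] \<open>i < Suc n\<close> \<open>j < Suc n\<close> unfolding rr
        by (auto simp: a_def less_Suc_eq)
      then show ?thesis
        using L[of i j] that by (cases "i = n \<or> j = n") (auto simp: L'_def B_def less_Suc_eq)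
    qed
    then show ?case by blast
  qed
  then show ?thesis using that by blast
qed

text \<open>Schur product theorem: a Gram factorization of \<open>B\<close> splits the form into a
  sum over \<open>k\<close> of forms of \<open>A\<close> with weights
  \<open>c i * L k i\<close>.\<close>

lemma psd_matrix_times:
  assumes "psd_matrix n A" "psd_matrix n B"
  shows "psd_matrix n (\<lambda>i j. A i j * B i j)"
proof -
  obtain L where L: "\<And>i j. i < n \<Longrightarrow> j < n \<Longrightarrow> B i j = (\<Sum>k<n. L k i * L k j)"
    using psd_matrix_gram[OF assms(2)] by blast
  have "0 \<le> (\<Sum>i<n. \<Sum>j<n. c i * (A i j * B i j) * c j)" for c
  proof -
    have "(\<Sum>i<n. \<Sum>j<n. c i * (A i j * B i j) * c j)
        = (\<Sum>i<n. \<Sum>j<n. \<Sum>k<n. (c i * L k i) * A i j * (c j * L k j))"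
      by (intro sum.cong refl) (simp add: L sum_distrib_left sum_distrib_right algebra_simps)
    also have "\<dots> = (\<Sum>i<n. \<Sum>k<n. \<Sum>j<n. (c i * L k i) * A i j * (c j * L k j))"
      by (intro sum.cong refl sum.swap)
    also have "\<dots> = (\<Sum>k<n. \<Sum>i<n. \<Sum>j<n. (c i * L k i) * A i j * (c j * L k j))"
      by (rule sum.swap)
    also have "\<dots> \<ge> 0"
      by (intro sum_nonneg psd_matrixD[OF assms(1)])
    finally show ?thesis .
  qed
  then show ?thesis
    using assms unfolding psd_matrix_def by auto
qed

section \<open>Entrywise power series and Gaussian matrices\<close>

lemma psd_matrix_one: "psd_matrix n (\<lambda>i j. 1)"
  by (rule psd_matrix_gramI[where m = "Suc 0" and L = "\<lambda>_ _. 1"]) simp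

lemma psd_matrix_add:
  assumes "psd_matrix n A" "psd_matrix n B"
  shows "psd_matrix n (\<lambda>i j. A i j + B i j)"
  using assms unfolding psd_matrix_def by (auto simp: algebra_simps sum.distrib)

lemma psd_matrix_cmult:
  assumes "psd_matrix n A" "0 \<le> t"
  shows "psd_matrix n (\<lambda>i j. t * A i j)"
proof -
  have "(\<Sum>i<n. \<Sum>j<n. c i * (t * A i j) * c j) = t * (\<Sum>i<n. \<Sum>j<n. c i * A i j * c j)" for c
    by (simp add: sum_distrib_left mult_ac)
  then show ?thesis using assms unfolding psd_matrix_def by auto
qed

lemma psd_matrix_power: "psd_matrix n A \<Longrightarrow> psd_matrix n (\<lambda>i j. A i j ^ k)"
  by (induction k) (auto intro: psd_matrix_one psd_matrix_times)

lemma psd_matrix_sum: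
  "(\<And>k. k \<in> I \<Longrightarrow> psd_matrix n (A k)) \<Longrightarrow> psd_matrix n (\<lambda>i j. \<Sum>k\<in>I. A k i j)"
proof (induction I rule: infinite_finite_induct)
  case (insert k I)
  then show ?case by (simp add: psd_matrix_add)
qed (simp_all add: psd_matrix_def)

text \<open>The entrywise partial sums of the exponential series are positive semidefinite by the
  Schur product theorem, and nonnegativity passes to the limit.\<close>

lemma psd_matrix_exp:
  assumes "psd_matrix n A"
  shows "psd_matrix n (\<lambda>i j. exp (A i j))"
proof -
  define E where "E N i j = (\<Sum>k<N. A i j ^ k /\<^sub>R fact k)" for N i j
  have lim: "(\<lambda>N. E N i j) \<longlonglongrightarrow> exp (A i j)" for i j
    using exp_converges[of "A i j"] unfolding sums_def E_def .
  have psd: "psd_matrix n (E N)" for N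
    unfolding E_def real_scaleR_def
    by (intro psd_matrix_sum psd_matrix_cmult psd_matrix_power assms) simp
  have "0 \<le> (\<Sum>i<n. \<Sum>j<n. c i * exp (A i j) * c j)" for c
  proof (rule LIMSEQ_le_const)
    show "(\<lambda>N. \<Sum>i<n. \<Sum>j<n. c i * E N i j * c j) \<longlonglongrightarrow> (\<Sum>i<n. \<Sum>j<n. c i * exp (A i j) * c j)"
      by (intro tendsto_intros lim)
  qed (use psd_matrixD[OF psd] in blast)
  then show ?thesis
    using assms unfolding psd_matrix_def by auto
qed

text \<open>The Gaussian is the entrywise product of a rank-one matrix and of
  \<open>exp ((2 * t) * A i j)\<close>.\<close>

lemma psd_matrix_gaussian:
  assumes "psd_matrix n A" "0 \<le> t"
  shows "psd_matrix n (\<lambda>i j. exp (- t * (A i i + A j j - 2 * A i j)))"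
proof -
  have "psd_matrix n (\<lambda>i j. exp (- t * A i i) * exp (- t * A j j))"
    by (rule psd_matrix_gramI[where m = "Suc 0" and L = "\<lambda>_ i. exp (- t * A i i)"]) simp
  moreover have "psd_matrix n (\<lambda>i j. exp ((2 * t) * A i j))"
    by (intro psd_matrix_exp psd_matrix_cmult) (use assms in auto)
  ultimately have "psd_matrix n (\<lambda>i j. (exp (- t * A i i) * exp (- t * A j j)) * exp ((2 * t) * A i j))"
    by (rule psd_matrix_times)
  moreover have "(exp (- t * A i i) * exp (- t * A j j)) * exp ((2 * t) * A i j)
       = exp (- t * (A i i + A j j - 2 * A i j))" for i j
    by (simp add: algebra_simps flip: exp_add)
  ultimately show ?thesis by simp
qed

section \<open>Energy of a positive semidefinite kernel\<close>

text \<open>Distinct coordinates are independent, as rectangles show. This evaluates the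
  off-diagonal terms of the sampled quadratic form.\<close>

lemma distr_PiM_pair:
  assumes "\<And>i. prob_space (M i)" "i \<in> I" "j \<in> I" "i \<noteq> j"
  shows "distr (PiM I M) (M i \<Otimes>\<^sub>M M j) (\<lambda>\<omega>. (\<omega> i, \<omega> j)) = M i \<Otimes>\<^sub>M M j"
proof -
  interpret product_prob_space M I by (rule product_prob_spaceI) (rule assms)
  interpret Mi: prob_space "M i" by (rule assms)
  interpret Mj: prob_space "M j" by (rule assms)
  interpret pair_sigma_finite "M i" "M j" ..
  have [measurable]: "(\<lambda>\<omega>. \<omega> i) \<in> measurable (PiM I M) (M i)" "(\<lambda>\<omega>. \<omega> j) \<in> measurable (PiM I M) (M j)"
    using assms by (auto intro!: measurable_component_singleton)
  show ?thesis
  proof (rule pair_measure_eqI[symmetric])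
    fix A B assume AB[measurable]: "A \<in> sets (M i)" "B \<in> sets (M j)"
    define X where "X k = (if k = i then A else B)" for k
    have "emeasure (distr (PiM I M) (M i \<Otimes>\<^sub>M M j) (\<lambda>\<omega>. (\<omega> i, \<omega> j))) (A \<times> B)
        = emeasure (PiM I M) {\<omega> \<in> space (PiM I M). \<forall>k\<in>{i, j}. \<omega> k \<in> X k}"
      using assms by (subst emeasure_distr) (auto intro!: arg_cong[where f = "emeasure _"] simp: X_def)
    also have "\<dots> = (\<Prod>k\<in>{i, j}. emeasure (M k) (X k))"
      using assms AB by (intro emeasure_PiM_Collect) (auto simp: X_def)
    also have "\<dots> = emeasure (M i) A * emeasure (M j) B"
      using assms by (simp add: X_def)
    finally show "emeasure (M i) A * emeasure (M j) B
        = emeasure (distr (PiM I M) (M i \<Otimes>\<^sub>M M j) (\<lambda>\<omega>. (\<omega> i, \<omega> j))) (A \<times> B)" ..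
  qed (auto intro: prob_space_imp_sigma_finite assms)
qed

text \<open>This is the double integral of \<open>k\<close> against the signed measure
  \<open>G - H\<close>, expanded bilinearly so that only product measures occur.\<close>

definition energy :: "('a \<Rightarrow> 'a \<Rightarrow> real) \<Rightarrow> 'a measure \<Rightarrow> 'a measure \<Rightarrow> real" where
  "energy k G H = (\<integral>p. k (fst p) (snd p) \<partial>(G \<Otimes>\<^sub>M G)) - (\<integral>p. k (fst p) (snd p) \<partial>(G \<Otimes>\<^sub>M H))
     - (\<integral>p. k (fst p) (snd p) \<partial>(H \<Otimes>\<^sub>M G)) + (\<integral>p. k (fst p) (snd p) \<partial>(H \<Otimes>\<^sub>M H))"

text \<open>Indices below \<open>n\<close> stand for samples of \<open>G\<close>, the others for
  samples of \<open>H\<close>.\<close>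

lemma sum_sum_sign:
  fixes a :: "bool \<Rightarrow> bool \<Rightarrow> real"
  shows "(\<Sum>i<2*n. \<Sum>j<2*n. (if i < n then 1 else -1) * (if j < n then 1 else -1) * a (i < n) (j < n))
       = (real n)\<^sup>2 * (a True True - a True False - a False True + a False False)"
    and "(\<Sum>i<2*n. (if i < n then 1 else -1) * b (i < n)) = real n * (b True - b False :: real)"
proof -
  have split: "(\<Sum>i<2*n. f i) = (\<Sum>i<n. f i) + (\<Sum>i\<in>{n..<2*n}. f i)" for f :: "nat \<Rightarrow> real"
    by (subst sum.union_disjoint[symmetric]) (auto intro!: sum.cong)
  show "(\<Sum>i<2*n. (if i < n then 1 else -1) * b (i < n)) = real n * (b True - b False)"
    for b :: "bool \<Rightarrow> real"
    unfolding split by (simp add: algebra_simps)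
  show "(\<Sum>i<2*n. \<Sum>j<2*n. (if i < n then 1 else -1) * (if j < n then 1 else -1) * a (i < n) (j < n))
       = (real n)\<^sup>2 * (a True True - a True False - a False True + a False False)"
    unfolding split by (simp add: power2_eq_square algebra_simps)
qed

text \<open>Evaluate the form at \<open>n\<close> independent samples of \<open>G\<close> with weight \<open>1\<close> and \<open>n\<close>
  of \<open>H\<close> with weight \<open>-1\<close>. In expectation, the diagonal contributes \<open>O(n)\<close> and the rest
  \<open>n\<^sup>2\<close> times the energy.\<close>

lemma energy_nonneg_augmented:
  fixes k :: "'a \<Rightarrow> 'a \<Rightarrow> real" and u :: "'a \<Rightarrow> real"
  assumes G: "prob_space G" and H: "prob_space H" and sets: "sets G = sets N" "sets H = sets N"
    and k: "(\<lambda>p. k (fst p) (snd p)) \<in> borel_measurable (N \<Otimes>\<^sub>M N)" and kB: "\<And>x y. \<bar>k x y\<bar> \<le> B"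
    and u: "u \<in> borel_measurable N" and uB: "\<And>x. \<bar>u x\<bar> \<le> U"
    and nonneg: "\<And>(n::nat) x c b. 0 \<le> (\<Sum>i<n. \<Sum>j<n. c i * k (x i) (x j) * c j)
      + 2 * b * (\<Sum>i<n. c i * u (x i)) + b\<^sup>2 * m"
  shows "0 \<le> energy k G H + 2 * b * ((\<integral>x. u x \<partial>G) - (\<integral>x. u x \<partial>H)) + b\<^sup>2 * m"
proof -
  interpret G: prob_space G by fact
  interpret H: prob_space H by fact
  define R where "R = energy k G H + 2 * b * ((\<integral>x. u x \<partial>G) - (\<integral>x. u x \<partial>H)) + b\<^sup>2 * m"
  have bound: "0 \<le> R + 4 * B * inverse (real n)" if n: "n > 0" for n
  proof -
    define V where "V s = (if s then G else H)" for s
    define s where "s i = (if i < n then 1 else -1 :: real)" for i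
    define M where "M i = V (i < n)" for i
    define P where "P = PiM {..<2*n} M"
    define I where "I p q = (\<integral>z. k (fst z) (snd z) \<partial>(V p \<Otimes>\<^sub>M V q))" for p q
    define J where "J p = (\<integral>z. u z \<partial>(V p))" for p
    have prob: "prob_space (M i)" for i
      using G H by (simp add: M_def V_def)
    have Vsets: "sets (V q) = sets N" for q
      using sets by (simp add: V_def)
    have Msets: "sets (M i) = sets N" for i
      by (simp add: M_def Vsets)
    interpret P: prob_space P
      unfolding P_def by (rule prob_space_PiM) (rule prob)
    have comp: "(\<lambda>\<omega>. \<omega> i) \<in> measurable P (M i)" if "i < 2*n" for i
      unfolding P_def using that by (intro measurable_component_singleton) simp
    have comp': "(\<lambda>\<omega>. \<omega> i) \<in> measurable P N" if "i < 2*n" for i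
      using comp[OF that] Msets[of i] by (simp cong: measurable_cong_sets)
    have kmeas: "(\<lambda>\<omega>. k (\<omega> i) (\<omega> j)) \<in> borel_measurable P" if "i < 2*n" "j < 2*n" for i j
      using measurable_compose[OF measurable_Pair[OF comp'[OF that(1)] comp'[OF that(2)]] k] by simp
    have umeas: "(\<lambda>\<omega>. u (\<omega> i)) \<in> borel_measurable P" if "i < 2*n" for i
      using measurable_compose[OF comp'[OF that] u] by simp
    have kint: "integrable P (\<lambda>\<omega>. k (\<omega> i) (\<omega> j))" if "i < 2*n" "j < 2*n" for i j
      by (rule P.integrable_const_bound[where B = B]) (use kB kmeas that in auto)
    have uint: "integrable P (\<lambda>\<omega>. u (\<omega> i))" if "i < 2*n" for i
      by (rule P.integrable_const_bound[where B = U]) (use uB umeas that in auto)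
    have Iij: "(\<integral>\<omega>. k (\<omega> i) (\<omega> j) \<partial>P) = I (i < n) (j < n)" if "i < 2*n" "j < 2*n" "i \<noteq> j" for i j
    proof -
      have meas: "(\<lambda>z. k (fst z) (snd z)) \<in> borel_measurable (M i \<Otimes>\<^sub>M M j)"
        using k by (simp add: measurable_cong_sets[OF sets_pair_measure_cong[OF Msets Msets]])
      have "I (i < n) (j < n) = (\<integral>z. k (fst z) (snd z) \<partial>(distr P (M i \<Otimes>\<^sub>M M j) (\<lambda>\<omega>. (\<omega> i, \<omega> j))))"
        unfolding P_def using that by (subst distr_PiM_pair[OF prob]) (auto simp: I_def M_def)
      also have "\<dots> = (\<integral>\<omega>. k (\<omega> i) (\<omega> j) \<partial>P)"
        by (subst integral_distr) (use meas comp that in \<open>auto intro!: measurable_Pair\<close>)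
      finally show ?thesis ..
    qed
    have Ji: "(\<integral>\<omega>. u (\<omega> i) \<partial>P) = J (i < n)" if "i < 2*n" for i
    proof -
      have "J (i < n) = (\<integral>z. u z \<partial>(distr P (M i) (\<lambda>\<omega>. \<omega> i)))"
        unfolding P_def using that by (subst distr_PiM_component[OF prob]) (auto simp: J_def M_def)
      also have "\<dots> = (\<integral>\<omega>. u (\<omega> i) \<partial>P)"
        by (subst integral_distr) (use comp that u Msets in \<open>auto cong: measurable_cong_sets\<close>)
      finally show ?thesis ..
    qed
    have IB: "\<bar>I p q\<bar> \<le> B" for p q
    proof -
      interpret Vp: prob_space "V p" using G H by (simp add: V_def)
      interpret Vq: prob_space "V q" using G H by (simp add: V_def)
      interpret VV: pair_prob_space "V p" "V q" ..
      have meas: "(\<lambda>z. k (fst z) (snd z)) \<in> borel_measurable (V p \<Otimes>\<^sub>M V q)"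
        using k by (simp add: measurable_cong_sets[OF sets_pair_measure_cong[OF Vsets Vsets]])
      have "\<bar>I p q\<bar> \<le> (\<integral>z. \<bar>k (fst z) (snd z)\<bar> \<partial>(V p \<Otimes>\<^sub>M V q))"
        unfolding I_def by (rule integral_abs_bound)
      also have "\<dots> \<le> B"
        by (rule VV.integral_le_const)
          (use kB meas in \<open>auto intro!: VV.integrable_const_bound[where B = B]\<close>)
      finally show ?thesis .
    qed
    \<comment> \<open>A diagonal term involves one sample twice, so independence fails; it differs
      from \<open>I\<close> by at most \<open>2 * B\<close>, both being bounded by
      \<open>B\<close>.\<close>
    have diag: "(\<integral>\<omega>. k (\<omega> i) (\<omega> i) \<partial>P) \<le> I (i < n) (i < n) + 2 * B" if "i < 2*n" for i
    proof -
      have "(\<integral>\<omega>. k (\<omega> i) (\<omega> i) \<partial>P) \<le> B"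
        by (rule P.integral_le_const) (use kB kint that in \<open>auto simp: abs_le_iff\<close>)
      then show ?thesis using IB[of "i < n" "i < n"] by (simp add: abs_le_iff)
    qed
    have entry: "(\<integral>\<omega>. s i * k (\<omega> i) (\<omega> j) * s j \<partial>P)
        \<le> s i * s j * I (i < n) (j < n) + (if i = j then 2 * B else 0)" if "i < 2*n" "j < 2*n" for i j
    proof -
      have "(\<integral>\<omega>. s i * k (\<omega> i) (\<omega> j) * s j \<partial>P) = s i * s j * (\<integral>\<omega>. k (\<omega> i) (\<omega> j) \<partial>P)"
        by simp
      moreover have "s i = 1 \<or> s i = -1" by (auto simp: s_def)
      ultimately show ?thesis
        using diag[OF that(1)] Iij[OF that] by (cases "i = j") auto
    qed
    have kint': "integrable P (\<lambda>\<omega>. s i * k (\<omega> i) (\<omega> j) * s j)" if "i < 2*n" "j < 2*n" for i j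
      using kint[OF that] by simp
    have uint': "integrable P (\<lambda>\<omega>. s i * u (\<omega> i))" if "i < 2*n" for i
      using uint[OF that] by simp
    have ints: "integrable P (\<lambda>\<omega>. \<Sum>i<2*n. \<Sum>j<2*n. s i * k (\<omega> i) (\<omega> j) * s j)"
      "integrable P (\<lambda>\<omega>. 2 * (real n * b) * (\<Sum>i<2*n. s i * u (\<omega> i)))"
      "integrable P (\<lambda>\<omega>. (real n * b)\<^sup>2 * m)"
      by (intro Bochner_Integration.integrable_sum integrable_mult_right kint' uint'; simp)+
    have E1: "(\<integral>\<omega>. (\<Sum>i<2*n. \<Sum>j<2*n. s i * k (\<omega> i) (\<omega> j) * s j) \<partial>P)
        = (\<Sum>i<2*n. \<Sum>j<2*n. (\<integral>\<omega>. s i * k (\<omega> i) (\<omega> j) * s j \<partial>P))"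
      by (subst Bochner_Integration.integral_sum)
        (auto simp del: integral_mult_right_zero integral_mult_left_zero
          intro!: sum.cong Bochner_Integration.integral_sum Bochner_Integration.integrable_sum kint')
    have E2: "(\<integral>\<omega>. 2 * (real n * b) * (\<Sum>i<2*n. s i * u (\<omega> i)) \<partial>P)
        = 2 * (real n * b) * (\<Sum>i<2*n. s i * J (i < n))"
    proof -
      have "(\<integral>\<omega>. (\<Sum>i<2*n. s i * u (\<omega> i)) \<partial>P) = (\<Sum>i<2*n. (\<integral>\<omega>. s i * u (\<omega> i) \<partial>P))"
        by (rule Bochner_Integration.integral_sum) (simp add: uint)
      then show ?thesis by (simp add: Ji)
    qed
    \<comment> \<open>The adjoined vector gets weight \<open>real n * b\<close>, so that all three
      terms scale like n^2.\<close>
    have "0 \<le> (\<integral>\<omega>. (\<Sum>i<2*n. \<Sum>j<2*n. s i * k (\<omega> i) (\<omega> j) * s j)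
        + 2 * (real n * b) * (\<Sum>i<2*n. s i * u (\<omega> i)) + (real n * b)\<^sup>2 * m \<partial>P)"
      using nonneg[where c = s and b = "real n * b"] by (intro Bochner_Integration.integral_nonneg) simp
    also have "\<dots> = (\<Sum>i<2*n. \<Sum>j<2*n. (\<integral>\<omega>. s i * k (\<omega> i) (\<omega> j) * s j \<partial>P))
        + 2 * (real n * b) * (\<Sum>i<2*n. s i * J (i < n)) + (real n * b)\<^sup>2 * m"
      by (simp only: Bochner_Integration.integral_add Bochner_Integration.integrable_add ints E1 E2)
        (simp add: P.prob_space)
    also have "\<dots> \<le> (\<Sum>i<2*n. \<Sum>j<2*n. s i * s j * I (i < n) (j < n) + (if i = j then 2 * B else 0))
        + 2 * (real n * b) * (\<Sum>i<2*n. s i * J (i < n)) + (real n * b)\<^sup>2 * m"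
      by (intro add_right_mono sum_mono entry) auto
    \<comment> \<open>There are \<open>2 * n\<close> diagonal terms with error \<open>2 * B\<close>
      each; divided by n^2 the total vanishes in the limit.\<close>
    also have "\<dots> = (\<Sum>i<2*n. \<Sum>j<2*n. s i * s j * I (i < n) (j < n)) + 4 * B * real n
        + 2 * (real n * b) * (\<Sum>i<2*n. s i * J (i < n)) + (real n * b)\<^sup>2 * m"
      by (simp add: sum.distrib)
    also have "\<dots> = (real n)\<^sup>2 * (R + 4 * B * inverse (real n))"
      using n unfolding s_def sum_sum_sign
      by (simp add: R_def energy_def I_def J_def V_def power2_eq_square algebra_simps)
    finally show ?thesis
      using n by (simp add: zero_le_mult_iff)
  qed
  have "(\<lambda>n. R + 4 * B * inverse (real n)) \<longlonglongrightarrow> R + 4 * B * 0"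
    by (intro tendsto_intros LIMSEQ_inverse_real_of_nat_add[of 0, simplified] tendsto_inverse_0_at_top filterlim_real_sequentially)
  then have "0 \<le> R + 4 * B * 0"
    by (rule LIMSEQ_le_const) (use bound in \<open>auto intro!: exI[of _ 1]\<close>)
  then show ?thesis by (simp add: R_def)
qed

section \<open>Reduction of the discrepancy to Gaussian kernels\<close>

text \<open>The integrand of the representation of \<open>s\<close> as a mixture of Gaussians. At
  \<open>u = 0\<close> it has the default value 0, on a null set.\<close>

definition gauss_gap :: "real \<Rightarrow> real \<Rightarrow> real" where
  "gauss_gap s u = (1 - exp (- (u * s)\<^sup>2)) / u\<^sup>2"

lemma gauss_gap_nonneg: "0 \<le> gauss_gap s u"
  by (simp add: gauss_gap_def)

lemma gauss_gap_measurable [measurable]: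
  "(\<lambda>z. gauss_gap (f z) (g z)) \<in> borel_measurable M"
  if [measurable]: "f \<in> borel_measurable M" "g \<in> borel_measurable M"
  unfolding gauss_gap_def by measurable

text \<open>With \<open>x = u\<^sup>2\<close>, the numerator is at most both \<open>x\<close> and 1;
  the two bounds handle the origin and infinity in one integrable majorant.\<close>

lemma gauss_gap_one_le: "gauss_gap 1 u \<le> 2 * inverse (1 + u\<^sup>2)"
proof (cases "u = 0")
  case False
  define x where "x = u\<^sup>2"
  have x: "x > 0" using False by (simp add: x_def)
  have "1 - exp (- x) \<le> x" using exp_ge_add_one_self[of "- x"] by simp
  moreover have "x * (1 - exp (- x)) \<le> x * 1" using x by (intro mult_left_mono) auto
  ultimately have "(1 - exp (- x)) * (1 + x) \<le> 2 * x" by (simp add: algebra_simps)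
  then have "(1 - exp (- x)) / x \<le> 2 * inverse (1 + x)" using x by (simp add: field_simps)
  then show ?thesis by (simp add: gauss_gap_def x_def)
qed (simp add: gauss_gap_def)

lemma integrable_gauss_gap_one: "integrable lborel (gauss_gap 1)"
proof (rule Bochner_Integration.integrable_bound)
  show "integrable lborel (\<lambda>u::real. 2 * inverse (1 + u\<^sup>2))"
    using integrable_inverse_1_plus_square by (simp add: set_integrable_def)
  show "AE u in lborel. norm (gauss_gap 1 u) \<le> norm (2 * inverse (1 + u\<^sup>2))"
    using gauss_gap_one_le gauss_gap_nonneg by (intro AE_I2) (simp add: abs_of_nonneg add_nonneg_nonneg)
qed measurable

definition gauss_gap_const :: real where
  "gauss_gap_const = (\<integral>u. gauss_gap 1 u \<partial>lborel)"

lemma gauss_gap_const_pos: "gauss_gap_const > 0"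
proof -
  have "gauss_gap_const \<noteq> 0"
  proof
    assume "gauss_gap_const = 0"
    then have "AE u in lborel. gauss_gap 1 u = 0"
      unfolding gauss_gap_const_def
      by (subst (asm) integral_nonneg_eq_0_iff_AE) (auto simp: integrable_gauss_gap_one gauss_gap_nonneg)
    with AE_lborel_singleton[of 0] have "AE u in (lborel :: real measure). False"
      by eventually_elim (simp add: gauss_gap_def)
    then show False by (simp add: eventually_False ae_filter_eq_bot_iff)
  qed
  moreover have "gauss_gap_const \<ge> 0"
    unfolding gauss_gap_const_def by (simp add: gauss_gap_nonneg)
  ultimately show ?thesis by simp
qed

text \<open>The substitution \<open>v = s * u\<close> gives a factor s^2 from the integrand and
  costs one factor \<open>s\<close> as Jacobian.\<close>

lemma
  assumes "0 \<le> s"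
  shows integrable_gauss_gap: "integrable lborel (gauss_gap s)"
    and integral_gauss_gap: "(\<integral>u. gauss_gap s u \<partial>lborel) = gauss_gap_const * s"
proof -
  have "integrable lborel (gauss_gap s) \<and> (\<integral>u. gauss_gap s u \<partial>lborel) = gauss_gap_const * s"
  proof (cases "s = 0")
    case True
    then have "gauss_gap s = (\<lambda>_. 0)" by (simp add: gauss_gap_def fun_eq_iff)
    then show ?thesis using True by simp
  next
    case False
    have scale: "gauss_gap s = (\<lambda>u. s\<^sup>2 * gauss_gap 1 (0 + s * u))"
      using False by (auto simp: gauss_gap_def fun_eq_iff power_mult_distrib mult.commute)
    have "gauss_gap_const = s * (\<integral>u. gauss_gap 1 (0 + s * u) \<partial>lborel)"
      unfolding gauss_gap_const_def
      using assms False by (subst lborel_integral_real_affine[of s _ 0]) auto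
    moreover have "integrable lborel (\<lambda>u. gauss_gap 1 (0 + s * u))"
      by (intro lborel_integrable_real_affine integrable_gauss_gap_one False)
    ultimately show ?thesis
      unfolding scale by (simp add: power2_eq_square)
  qed
  then show "integrable lborel (gauss_gap s)" "(\<integral>u. gauss_gap s u \<partial>lborel) = gauss_gap_const * s"
    by auto
qed

text \<open>The integrand is nonnegative, so integrability of the inner integral
  \<open>gauss_gap_const * f x\<close> suffices for Fubini. It is applied to the metric on product
  measures.\<close>

lemma
  fixes f :: "'a \<Rightarrow> real"
  assumes "prob_space M" and f: "integrable M f" and nonneg: "\<And>x. 0 \<le> f x"
  shows integrable_gauss_gap_mean: "integrable lborel (\<lambda>u. \<integral>x. gauss_gap (f x) u \<partial>M)"
    and integral_gauss_gap_mean: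
      "(\<integral>u. (\<integral>x. gauss_gap (f x) u \<partial>M) \<partial>lborel) = gauss_gap_const * (\<integral>x. f x \<partial>M)"
proof -
  interpret M: prob_space M by fact
  interpret pair_sigma_finite M "lborel :: real measure" ..
  have [measurable]: "f \<in> borel_measurable M" using f by auto
  have int: "integrable (M \<Otimes>\<^sub>M lborel) (\<lambda>(x, u). gauss_gap (f x) u)"
  proof (rule Fubini_integrable)
    show "integrable M (\<lambda>x. \<integral>u. norm (case (x, u) of (x, u) \<Rightarrow> gauss_gap (f x) u) \<partial>lborel)"
      using f by (simp add: gauss_gap_nonneg integral_gauss_gap nonneg)
    show "AE x in M. integrable lborel (\<lambda>u. case (x, u) of (x, u) \<Rightarrow> gauss_gap (f x) u)"
      by (simp add: integrable_gauss_gap nonneg)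
  qed measurable
  show "integrable lborel (\<lambda>u. \<integral>x. gauss_gap (f x) u \<partial>M)"
    using integrable_snd[OF int] .
  show "(\<integral>u. (\<integral>x. gauss_gap (f x) u \<partial>M) \<partial>lborel) = gauss_gap_const * (\<integral>x. f x \<partial>M)"
    using Fubini_integral[OF int] by (simp add: integral_gauss_gap nonneg)
qed

section \<open>Gaussian means as functions of the scale \<open>u\<close>\<close>

lemma (in prob_space) integrable_gauss:
  fixes f :: "'a \<Rightarrow> real"
  assumes "f \<in> borel_measurable M"
  shows "integrable M (\<lambda>x. exp (- (u * f x)\<^sup>2))"
  by (rule integrable_const_bound[where B = 1]) (use assms in auto)

lemma (in prob_space) gauss_gap_mean:
  fixes f :: "'a \<Rightarrow> real"
  assumes "f \<in> borel_measurable M"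
  shows "(\<integral>x. gauss_gap (f x) u \<partial>M) = (1 - (\<integral>x. exp (- (u * f x)\<^sup>2) \<partial>M)) / u\<^sup>2"
  unfolding gauss_gap_def using integrable_gauss[OF assms] by (simp add: prob_space)

lemma (in prob_space) continuous_gauss_mean:
  fixes f :: "'a \<Rightarrow> real"
  assumes [measurable]: "f \<in> borel_measurable M"
  shows "continuous_on UNIV (\<lambda>u. \<integral>x. exp (- (u * f x)\<^sup>2) \<partial>M)"
proof (rule continuous_on_sequentiallyI)
  fix X :: "nat \<Rightarrow> real" and a assume X: "X \<longlonglongrightarrow> a"
  show "(\<lambda>n. \<integral>x. exp (- (X n * f x)\<^sup>2) \<partial>M) \<longlonglongrightarrow> (\<integral>x. exp (- (a * f x)\<^sup>2) \<partial>M)"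
    by (rule integral_dominated_convergence[where w = "\<lambda>_. 1"])
      (auto intro!: tendsto_intros X)
qed

text \<open>The set where \<open>f\<close> is nonzero is open; if nonempty, it contains an interval
  of positive length.\<close>

lemma continuous_AE_zero_imp_zero:
  fixes f :: "real \<Rightarrow> real"
  assumes cont: "continuous_on UNIV f" and AE: "AE u in lborel. f u = 0"
  shows "f u = 0"
proof (rule ccontr)
  assume u: "f u \<noteq> 0"
  have "open {v. f v \<noteq> 0}"
    by (intro open_Collect_neq cont continuous_on_const)
  then obtain e where e: "e > 0" "ball u e \<subseteq> {v. f v \<noteq> 0}"
    using u by (auto simp: open_contains_ball)
  from AE have "AE v in lborel. \<not> (v \<in> {u - e<..<u + e})"
    by eventually_elim (use e in \<open>auto simp: subset_iff dist_real_def abs_less_iff\<close>)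
  then have "emeasure lborel {v \<in> space lborel. v \<in> {u - e<..<u + e}} = 0"
    by (rule emeasure_eq_0_AE)
  moreover have "{v \<in> space lborel. v \<in> {u - e<..<u + e}} = {u - e<..<u + e}" by auto
  ultimately show False
    using e by (simp add: ennreal_eq_0_iff)
qed

text \<open>Measurability is assumed over \<open>N\<close> alone; equality of the sigma-algebras
  transfers it to all four products of \<open>G\<close> and \<open>H\<close>.\<close>

locale prob_pair =
  fixes G H N :: "'a measure"
  assumes prob: "prob_space G" "prob_space H" and sets: "sets G = sets N" "sets H = sets N"
begin

lemma measurable_pairs:
  assumes "f \<in> borel_measurable (N \<Otimes>\<^sub>M N)" "A \<in> {G, H}" "B \<in> {G, H}"
  shows "f \<in> borel_measurable (A \<Otimes>\<^sub>M B)"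
proof -
  have AB: "sets A = sets N" "sets B = sets N" using assms sets by auto
  show ?thesis
    using assms(1) by (simp add: measurable_cong_sets[OF sets_pair_measure_cong[OF AB]])
qed

lemma prob_pairs:
  assumes "A \<in> {G, H}" "B \<in> {G, H}"
  shows "prob_space (A \<Otimes>\<^sub>M B)"
proof -
  interpret A: prob_space A using assms prob by auto
  interpret B: prob_space B using assms prob by auto
  interpret pair_prob_space A B ..
  show ?thesis by (rule prob_space_axioms)
qed

text \<open>Integrate \<open>1 - exp (- u\<^sup>2 \<rho>\<^sup>2)\<close> against \<open>du / u\<^sup>2\<close>: the constant \<open>1\<close> has energy zero.\<close>

lemma
  fixes \<rho> :: "'a \<Rightarrow> 'a \<Rightarrow> real"
  assumes meas: "(\<lambda>z. \<rho> (fst z) (snd z)) \<in> borel_measurable (N \<Otimes>\<^sub>M N)"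
    and nonneg: "\<And>x y. 0 \<le> \<rho> x y"
    and int: "\<And>A B. A \<in> {G, H} \<Longrightarrow> B \<in> {G, H} \<Longrightarrow> integrable (A \<Otimes>\<^sub>M B) (\<lambda>z. \<rho> (fst z) (snd z))"
    and gauss: "\<And>u. 0 \<le> energy (\<lambda>x y. exp (- (u * \<rho> x y)\<^sup>2)) G H"
  shows energy_nonpos: "energy \<rho> G H \<le> 0"
    and energy_zero_imp: "energy \<rho> G H = 0 \<Longrightarrow> energy (\<lambda>x y. exp (- (u * \<rho> x y)\<^sup>2)) G H = 0"
proof -
  define E where "E u = energy (\<lambda>x y. exp (- (u * \<rho> x y)\<^sup>2)) G H" for u
  define \<Phi> where "\<Phi> A B u = (\<integral>z. gauss_gap (\<rho> (fst z) (snd z)) u \<partial>(A \<Otimes>\<^sub>M B))" for A B u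
  have m: "(\<lambda>z. \<rho> (fst z) (snd z)) \<in> borel_measurable (A \<Otimes>\<^sub>M B)" if "A \<in> {G, H}" "B \<in> {G, H}" for A B
    by (rule measurable_pairs[OF meas that])
  have \<Phi>int: "integrable lborel (\<Phi> A B)"
    and \<Phi>val: "(\<integral>u. \<Phi> A B u \<partial>lborel) = gauss_gap_const * (\<integral>z. \<rho> (fst z) (snd z) \<partial>(A \<Otimes>\<^sub>M B))"
    if "A \<in> {G, H}" "B \<in> {G, H}" for A B
    unfolding \<Phi>_def
    by (intro integrable_gauss_gap_mean integral_gauss_gap_mean prob_pairs int nonneg that)+
  \<comment> \<open>The constant 1 cancels among the four terms. At \<open>u = 0\<close> both sides
    are 0 by the convention for division.\<close>
  have \<Phi>E: "\<Phi> G G u - \<Phi> G H u - \<Phi> H G u + \<Phi> H H u = - (E u / u\<^sup>2)" for u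
  proof -
    have "\<Phi> A B u = (1 - (\<integral>z. exp (- (u * \<rho> (fst z) (snd z))\<^sup>2) \<partial>(A \<Otimes>\<^sub>M B))) / u\<^sup>2"
      if "A \<in> {G, H}" "B \<in> {G, H}" for A B
      unfolding \<Phi>_def by (rule prob_space.gauss_gap_mean[OF prob_pairs m]) (use that in auto)
    then show ?thesis
      by (simp add: E_def energy_def diff_divide_distrib add_divide_distrib)
  qed
  have Eint: "integrable lborel (\<lambda>u. E u / u\<^sup>2)"
  proof -
    have "integrable lborel (\<lambda>u. - (\<Phi> G G u - \<Phi> G H u - \<Phi> H G u + \<Phi> H H u))"
      by (intro Bochner_Integration.integrable_minus Bochner_Integration.integrable_add
          Bochner_Integration.integrable_diff \<Phi>int) auto
    then show ?thesis unfolding \<Phi>E by simp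
  qed
  have "gauss_gap_const * energy \<rho> G H = (\<integral>u. \<Phi> G G u - \<Phi> G H u - \<Phi> H G u + \<Phi> H H u \<partial>lborel)"
    using \<Phi>int by (simp add: \<Phi>val energy_def algebra_simps)
  also have "\<dots> = - (\<integral>u. E u / u\<^sup>2 \<partial>lborel)"
    unfolding \<Phi>E by simp
  finally have main: "gauss_gap_const * energy \<rho> G H = - (\<integral>u. E u / u\<^sup>2 \<partial>lborel)" .
  have E0: "0 \<le> E u / u\<^sup>2" for u using gauss by (simp add: E_def)
  have "gauss_gap_const * energy \<rho> G H \<le> 0"
    unfolding main by (simp add: E0)
  then show "energy \<rho> G H \<le> 0"
    using gauss_gap_const_pos by (simp add: mult_le_0_iff)
  assume "energy \<rho> G H = 0"
  then have "(\<integral>u. E u / u\<^sup>2 \<partial>lborel) = 0" using main by simp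
  then have "AE u in lborel. E u / u\<^sup>2 = 0"
    using integral_nonneg_eq_0_iff_AE[OF Eint] E0 by simp
  \<comment> \<open>The quotient says nothing about \<open>E 0\<close>, so the null set of
    \<open>u = 0\<close> is removed here and recovered by continuity.\<close>
  then have "AE u in lborel. E u = 0"
    using AE_lborel_singleton[of 0] by eventually_elim simp
  moreover have "continuous_on UNIV E"
    unfolding E_def energy_def
    by (intro continuous_intros prob_space.continuous_gauss_mean[OF prob_pairs] m) auto
  ultimately show "energy (\<lambda>x y. exp (- (u * \<rho> x y)\<^sup>2)) G H = 0"
    using continuous_AE_zero_imp_zero[of E u] by (simp add: E_def)
qed

end

section \<open>The discrepancy of a metric as an energy\<close>

lemma (in pair_prob_space) integrable_fst_snd:
  fixes f :: "_ \<Rightarrow> real"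
  shows "integrable M1 f \<Longrightarrow> integrable (M1 \<Otimes>\<^sub>M M2) (\<lambda>z. f (fst z))"
    and "integrable M2 g \<Longrightarrow> integrable (M1 \<Otimes>\<^sub>M M2) (\<lambda>z. g (snd z) :: real)"
proof -
  assume f: "integrable M1 f"
  then have [measurable]: "f \<in> borel_measurable M1" by auto
  show "integrable (M1 \<Otimes>\<^sub>M M2) (\<lambda>z. f (fst z))"
  proof (rule Fubini_integrable)
    show "integrable M1 (\<lambda>x. \<integral>y. norm (f (fst (x, y))) \<partial>M2)"
      using f by (simp add: M2.prob_space)
    show "(\<lambda>z. f (fst z)) \<in> borel_measurable (M1 \<Otimes>\<^sub>M M2)" by measurable
  qed simp
next
  assume g: "integrable M2 g"
  then have [measurable]: "g \<in> borel_measurable M2" by auto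
  show "integrable (M1 \<Otimes>\<^sub>M M2) (\<lambda>z. g (snd z))"
  proof (rule Fubini_integrable)
    show "AE x in M1. integrable M2 (\<lambda>y. g (snd (x, y)))"
      using g by simp
    show "(\<lambda>z. g (snd z)) \<in> borel_measurable (M1 \<Otimes>\<^sub>M M2)" by measurable
  qed simp
qed

context prob_pair begin

text \<open>The triangle inequality bounds \<open>\<rho>\<close> by integrable functions of single
  coordinates; then Fubini converts the iterated integrals into integrals over products.\<close>

lemma
  fixes \<rho> :: "'a \<Rightarrow> 'a \<Rightarrow> real"
  assumes meas: "(\<lambda>z. \<rho> (fst z) (snd z)) \<in> borel_measurable (N \<Otimes>\<^sub>M N)"
    and metric: "Metric_space UNIV \<rho>"
    and moment: "finite_first_moment \<rho> G" "finite_first_moment \<rho> H"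
  shows integrable_metric_pairs:
      "A \<in> {G, H} \<Longrightarrow> B \<in> {G, H} \<Longrightarrow> integrable (A \<Otimes>\<^sub>M B) (\<lambda>z. \<rho> (fst z) (snd z))"
    and metric_discrepancy_eq_energy: "metric_discrepancy \<rho> G H = energy \<rho> G H"
proof -
  interpret Metric_space UNIV \<rho> by fact
  have int: "integrable (A \<Otimes>\<^sub>M B) (\<lambda>z. \<rho> (fst z) (snd z))" if AB: "A \<in> {G, H}" "B \<in> {G, H}" for A B
  proof -
    interpret A: prob_space A using AB prob by auto
    interpret B: prob_space B using AB prob by auto
    interpret pair_prob_space A B ..
    obtain p where p: "integrable A (\<lambda>x. \<rho> x p)"
      using AB moment by (auto simp: finite_first_moment_def)
    obtain q where q: "integrable B (\<lambda>x. \<rho> x q)"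
      using AB moment by (auto simp: finite_first_moment_def)
    show ?thesis
    proof (rule Bochner_Integration.integrable_bound)
      show "integrable (A \<Otimes>\<^sub>M B) (\<lambda>z. \<rho> (fst z) p + \<rho> p q + \<rho> (snd z) q)"
        by (intro Bochner_Integration.integrable_add integrable_fst_snd(1)[OF p] integrable_fst_snd(2)[OF q]) simp
      \<comment> \<open>The base points come from separate moment conditions and may differ, hence
        the detour through both.\<close>
      have "\<rho> x y \<le> \<rho> x p + \<rho> p q + \<rho> y q" for x y
        using triangle[of x p y] triangle[of p q y] commute[of q y] by simp
      then show "AE z in A \<Otimes>\<^sub>M B. norm (\<rho> (fst z) (snd z)) \<le> norm (\<rho> (fst z) p + \<rho> p q + \<rho> (snd z) q)"
        by (intro AE_I2) (simp add: abs_of_nonneg)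
    qed (rule measurable_pairs[OF meas AB])
  qed
  then show "A \<in> {G, H} \<Longrightarrow> B \<in> {G, H} \<Longrightarrow> integrable (A \<Otimes>\<^sub>M B) (\<lambda>z. \<rho> (fst z) (snd z))" .
  have fub: "integrable A (\<lambda>x. \<integral>y. \<rho> x y \<partial>B)"
    "(\<integral>x. (\<integral>y. \<rho> x y \<partial>B) \<partial>A) = (\<integral>z. \<rho> (fst z) (snd z) \<partial>(A \<Otimes>\<^sub>M B))"
    if AB: "A \<in> {G, H}" "B \<in> {G, H}" for A B
  proof -
    interpret A: prob_space A using AB prob by auto
    interpret B: prob_space B using AB prob by auto
    interpret pair_prob_space A B ..
    show "integrable A (\<lambda>x. \<integral>y. \<rho> x y \<partial>B)"
      using integrable_fst'[OF int[OF AB]] by simp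
    show "(\<integral>x. (\<integral>y. \<rho> x y \<partial>B) \<partial>A) = (\<integral>z. \<rho> (fst z) (snd z) \<partial>(A \<Otimes>\<^sub>M B))"
      using integral_fst'[OF int[OF AB]] by simp
  qed
  show "metric_discrepancy \<rho> G H = energy \<rho> G H"
    unfolding metric_discrepancy_def diff_integral_def energy_def
    using fub by simp
qed

end

section \<open>Separating families of continuous functions\<close>

text \<open>For a multiplicatively closed \<open>S\<close> these linear combinations already form
  the algebra that Stone--Weierstrass requires.\<close>

inductive_set linear_hull :: "('a \<Rightarrow> real) set \<Rightarrow> ('a \<Rightarrow> real) set" for S where
  scale: "f \<in> S \<Longrightarrow> (\<lambda>x. c * f x) \<in> linear_hull S"
| add: "f \<in> linear_hull S \<Longrightarrow> g \<in> linear_hull S \<Longrightarrow> (\<lambda>x. f x + g x) \<in> linear_hull S"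

lemma linear_hull_scale:
  assumes "f \<in> linear_hull S"
  shows "(\<lambda>x. c * f x) \<in> linear_hull S"
  using assms
proof induction
  case (scale f d)
  then show ?case using linear_hull.scale[of f S "c * d"] by (simp add: mult.assoc)
next
  case (add f g)
  then show ?case using linear_hull.add[OF add.IH] by (simp add: distrib_left)
qed

text \<open>Nested inductions distribute the product until only products of two generators
  remain.\<close>

lemma linear_hull_mult:
  assumes mult: "\<And>f g. f \<in> S \<Longrightarrow> g \<in> S \<Longrightarrow> (\<lambda>x. f x * g x) \<in> S"
    and f: "f \<in> linear_hull S" and g: "g \<in> linear_hull S"
  shows "(\<lambda>x. f x * g x) \<in> linear_hull S"
  using f
proof induction
  case (scale f c)
  have "(\<lambda>x. f x * g x) \<in> linear_hull S"
    using g
  proof induction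
    case (scale g d)
    then show ?case
      using linear_hull.scale[OF mult[OF \<open>f \<in> S\<close> scale], of d] by (simp add: mult_ac)
  next
    case (add g g')
    then show ?case using linear_hull.add[OF add.IH] by (simp add: distrib_left)
  qed
  from linear_hull_scale[OF this, of c] show ?case by (simp add: mult.assoc)
next
  case (add f f')
  then show ?case using linear_hull.add[OF add.IH] by (simp add: distrib_right)
qed

text \<open>A linear map on the reals is multiplication by \<open>l 1\<close>, so induction on
  \<open>p\<close> uses only the closure properties. It keeps polynomials in an approximant inside
  the algebra.\<close>

lemma polynomial_closure:
  fixes p :: "real \<Rightarrow> real"
  assumes "real_polynomial_function p" "g \<in> A"
    and const: "\<And>c. (\<lambda>_. c) \<in> A"
    and add: "\<And>f g. f \<in> A \<Longrightarrow> g \<in> A \<Longrightarrow> (\<lambda>x. f x + g x) \<in> A"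
    and mult: "\<And>f g. f \<in> A \<Longrightarrow> g \<in> A \<Longrightarrow> (\<lambda>x. f x * g x) \<in> A"
  shows "(\<lambda>x. p (g x)) \<in> A"
  using assms(1)
proof induction
  case (linear l)
  have "l y = l 1 * y" for y
    using linear_scale[OF bounded_linear.linear[OF linear], of y 1]
    by (simp only: real_scaleR_def mult_1_left mult_1_right mult.commute)
  then have "(\<lambda>x. l (g x)) = (\<lambda>x. l 1 * g x)" by (intro ext)
  then show ?case using mult[OF const[of "l 1"] \<open>g \<in> A\<close>] by (simp only:)
next
  case (const c)
  show ?case by (rule assms(3))
next
  case (add f h)
  then show ?case by (intro assms(4))
next
  case (mult f h)
  then show ?case by (intro assms(5))
qed

text \<open>Ulam's theorem, read off from inner regularity: the total mass 1 is the supremum of the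
  masses of compact sets.\<close>

lemma tight_prob:
  fixes G :: "'a::polish_space measure"
  assumes "prob_space G" "sets G = sets borel" "e > 0"
  obtains C where "compact C" "measure G (- C) < e"
proof -
  interpret prob_space G by fact
  have sp: "space G = UNIV" using sets_eq_imp_space_eq[OF assms(2)] by simp
  have "emeasure G UNIV = (SUP K \<in> {K. K \<subseteq> UNIV \<and> compact K}. emeasure G K)"
    by (rule inner_regular) (use assms in auto)
  moreover have "emeasure G UNIV = 1" using emeasure_space_1 sp by simp
  moreover have "ennreal (1 - e) < 1" using assms(3) by (simp add: ennreal_less_one_iff)
  ultimately have "ennreal (1 - e) < (SUP K \<in> {K. K \<subseteq> UNIV \<and> compact K}. emeasure G K)"
    by simp
  then obtain C where C: "compact C" "ennreal (1 - e) < emeasure G C"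
    by (auto simp: less_SUP_iff)
  have Cs: "C \<in> sets G" using C assms by (simp add: borel_compact)
  have "1 - e < measure G C"
    using C(2) ennreal_leI[of "measure G C" "1 - e"]
    by (auto simp: emeasure_eq_measure not_le[symmetric])
  moreover have "measure G (- C) = 1 - measure G C"
    using prob_compl[OF Cs] sp by (simp add: Compl_eq_Diff_UNIV)
  ultimately show ?thesis using C that by simp
qed

text \<open>Closed sets form a generator stable under intersection, and their indicators are bounded
  limits of continuous functions.\<close>

lemma measure_eqI_continuous_integrals:
  fixes G H :: "'a::polish_space measure"
  assumes "prob_space G" "prob_space H" "sets G = sets borel" "sets H = sets borel"
    and eq: "\<And>F. continuous_on UNIV F \<Longrightarrow> (\<And>x. \<bar>F x\<bar> \<le> 1) \<Longrightarrow> (\<integral>x. F x \<partial>G) = (\<integral>x. F x \<partial>H :: real)"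
  shows "G = H"
proof -
  interpret G: prob_space G by fact
  interpret H: prob_space H by fact
  have closed_eq: "emeasure G A = emeasure H A" if A: "closed A" for A
  \<comment> \<open>By convention \<open>infdist\<close> to the empty set is 0, so the approximants
    below would be constantly 1 there.\<close>
  proof (cases "A = {}")
    case False
    define F where "F n x = max 0 (1 - real n * infdist x A)" for n x
    have cont: "continuous_on UNIV (F n)" for n
      unfolding F_def by (intro continuous_intros)
    have bound: "\<bar>F n x\<bar> \<le> 1" for n x
      by (auto simp: F_def infdist_nonneg)
    have lim: "(\<lambda>n. F n x) \<longlonglongrightarrow> indicator A x" for x
    proof (cases "x \<in> A")
      case True
      then show ?thesis by (simp add: F_def)
    next
      assume x: "x \<notin> A"
      then have pos: "infdist x A > 0"
        using False A by (simp add: infdist_pos_not_in_closed)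
      obtain N where N: "1 < real N * infdist x A"
        using reals_Archimedean3[OF pos] by blast
      have "F n x = 0" if "n \<ge> N" for n
      proof -
        have "real N * infdist x A \<le> real n * infdist x A"
          using that pos by (intro mult_right_mono) auto
        then show ?thesis using N by (simp add: F_def)
      qed
      then have "eventually (\<lambda>n. F n x = 0) sequentially"
        by (auto simp: eventually_sequentially)
      then show ?thesis using x by (simp add: tendsto_eventually)
    qed
    have conv: "(\<lambda>n. \<integral>x. F n x \<partial>M) \<longlonglongrightarrow> measure M A" if "prob_space M" "sets M = sets borel" for M
    proof -
      interpret prob_space M by fact
      have [measurable]: "F n \<in> borel_measurable M" for n
        using borel_measurable_continuous_onI[OF cont[of n]] that by (simp cong: measurable_cong_sets)
      have [measurable]: "A \<in> sets M" using A that by simp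
      have "(\<lambda>n. \<integral>x. F n x \<partial>M) \<longlonglongrightarrow> (\<integral>x. indicator A x \<partial>M)"
        by (rule integral_dominated_convergence[where w = "\<lambda>_. 1"]) (use lim bound in auto)
      moreover have "A \<inter> space M = A" using sets_eq_imp_space_eq[OF that(2)] by simp
      ultimately show ?thesis by simp
    qed
    have "measure G A = measure H A"
      using LIMSEQ_unique[OF conv[OF assms(1,3)]] conv[OF assms(2,4)] eq[OF cont bound] by simp
    then show ?thesis by (simp add: G.emeasure_eq_measure H.emeasure_eq_measure)
  qed simp
  show ?thesis
  proof (rule measure_eqI_generator_eq[where E = "Collect closed" and \<Omega> = UNIV and A = "\<lambda>_. UNIV"])
    show "sets G = sigma_sets UNIV (Collect closed)" "sets H = sigma_sets UNIV (Collect closed)"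
      unfolding assms(3,4) by (simp_all add: borel_eq_closed)
    show "emeasure G X = emeasure H X" if "X \<in> Collect closed" for X
      using that closed_eq by blast
  qed (auto simp: Int_stable_def)
qed

text \<open>Stone--Weierstrass on a compact set carrying most of the mass yields an approximant that
  may be large elsewhere; composing it with a polynomial close to a truncation keeps it bounded.\<close>

lemma measure_eqI_separating_monoid:
  fixes G H :: "'a::polish_space measure" and S :: "('a \<Rightarrow> real) set"
  assumes GH: "prob_space G" "prob_space H" "sets G = sets borel" "sets H = sets borel"
    and cont: "\<And>f. f \<in> S \<Longrightarrow> continuous_on UNIV f"
    and bdd: "\<And>f. f \<in> S \<Longrightarrow> \<exists>B. \<forall>x. \<bar>f x\<bar> \<le> B"
    and one: "(\<lambda>_. 1) \<in> S"
    and mult: "\<And>f g. f \<in> S \<Longrightarrow> g \<in> S \<Longrightarrow> (\<lambda>x. f x * g x) \<in> S"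
    and sep: "\<And>x y. x \<noteq> y \<Longrightarrow> \<exists>f\<in>S. f x \<noteq> f y"
    and eq: "\<And>f. f \<in> S \<Longrightarrow> (\<integral>x. f x \<partial>G) = (\<integral>x. f x \<partial>H)"
  shows "G = H"
proof (rule measure_eqI_continuous_integrals[OF GH])
  interpret G: prob_space G by fact
  interpret H: prob_space H by fact
  have meas: "f \<in> borel_measurable G" "f \<in> borel_measurable H" if "continuous_on UNIV f" for f :: "'a \<Rightarrow> real"
    using borel_measurable_continuous_onI[OF that] GH by (simp_all cong: measurable_cong_sets)
  have int: "integrable G f" "integrable H f" if "continuous_on UNIV f" "\<And>x. \<bar>f x\<bar> \<le> B" for f :: "'a \<Rightarrow> real" and B
    by (rule G.integrable_const_bound[where B = B] H.integrable_const_bound[where B = B];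
        use that meas in auto)+
  define A where "A = linear_hull S"
  have A: "continuous_on UNIV f" "\<exists>B. \<forall>x. \<bar>f x\<bar> \<le> B" "(\<integral>x. f x \<partial>G) = (\<integral>x. f x \<partial>H)" if "f \<in> A" for f
  proof -
    have "continuous_on UNIV f \<and> (\<exists>B. \<forall>x. \<bar>f x\<bar> \<le> B) \<and> (\<integral>x. f x \<partial>G) = (\<integral>x. f x \<partial>H)"
      using that unfolding A_def
    proof induction
      case (scale f c)
      from bdd[OF this] obtain B where "\<And>x. \<bar>f x\<bar> \<le> B" by blast
      then have "\<bar>c * f x\<bar> \<le> \<bar>c\<bar> * B" for x by (simp add: abs_mult mult_left_mono)
      then show ?case using cont[OF scale] eq[OF scale] by (auto intro!: continuous_intros)
    next
      case (add f g)
      then obtain B B' where B: "\<And>x. \<bar>f x\<bar> \<le> B" "\<And>x. \<bar>g x\<bar> \<le> B'" by blast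
      have "\<bar>f x + g x\<bar> \<le> B + B'" for x using B[of x] by linarith
      moreover have "(\<integral>x. f x + g x \<partial>G) = (\<integral>x. f x + g x \<partial>H)"
        using add int[of f B] int[of g B'] B by simp
      ultimately show ?case using add by (auto intro!: continuous_intros)
    qed
    then show "continuous_on UNIV f" "\<exists>B. \<forall>x. \<bar>f x\<bar> \<le> B" "(\<integral>x. f x \<partial>G) = (\<integral>x. f x \<partial>H)" by auto
  qed
  have Aadd: "(\<lambda>x. f x + g x) \<in> A" if "f \<in> A" "g \<in> A" for f g
    using that linear_hull.add by (simp add: A_def)
  have Amult: "(\<lambda>x. f x * g x) \<in> A" if "f \<in> A" "g \<in> A" for f g
    using that unfolding A_def by (intro linear_hull_mult mult)
  have Aconst: "(\<lambda>_. c) \<in> A" for c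
    using linear_hull.scale[OF one, of c] by (simp add: A_def)
  have SA: "f \<in> A" if "f \<in> S" for f
    using linear_hull.scale[OF that, of 1] by (simp add: A_def)

  fix F :: "'a \<Rightarrow> real" assume F: "continuous_on UNIV F" "\<And>x. \<bar>F x\<bar> \<le> 1"
  have approx: "\<bar>(\<integral>x. F x \<partial>G) - (\<integral>x. F x \<partial>H)\<bar> \<le> 12 * e" if e: "0 < e" "e < 1" for e
  proof -
    obtain C1 where C1: "compact C1" "measure G (- C1) < e" using tight_prob[OF GH(1,3) e(1)] .
    obtain C2 where C2: "compact C2" "measure H (- C2) < e" using tight_prob[OF GH(2,4) e(1)] .
    define C where "C = C1 \<union> C2"
    have C: "compact C" using C1 C2 by (simp add: C_def compact_Un)
    have [measurable]: "- C \<in> sets borel" "- C1 \<in> sets borel" "- C2 \<in> sets borel"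
      using C C1 C2 by (auto intro!: borel_open simp: open_Compl compact_imp_closed)
    have CG: "measure G (- C) \<le> e"
      using G.finite_measure_mono[of "- C" "- C1"] C1 GH by (auto simp: C_def)
    have CH: "measure H (- C) \<le> e"
      using H.finite_measure_mono[of "- C" "- C2"] C2 GH by (auto simp: C_def)
    interpret function_ring_on A C
    proof
      fix x y :: 'a assume "x \<noteq> y"
      then show "\<exists>f\<in>A. f x \<noteq> f y" using sep SA by blast
    next
      fix f assume "f \<in> A"
      then show "continuous_on C f" using A(1) continuous_on_subset by blast
    next
      show "compact C" by (rule C)
      show "(\<lambda>_. c) \<in> A" for c by (rule Aconst)
      show "(\<lambda>x. f x + g x) \<in> A" "(\<lambda>x. f x * g x) \<in> A" if "f \<in> A" "g \<in> A" for f g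
        using that by (rule Aadd, rule Amult)
    qed
    obtain g where g: "g \<in> A" "\<And>x. x \<in> C \<Longrightarrow> \<bar>F x - g x\<bar> < e"
      using Stone_Weierstrass_basic[OF continuous_on_subset[OF F(1)] e(1)] by auto
    obtain B where B: "\<And>x. \<bar>g x\<bar> \<le> B" using A(2)[OF g(1)] by blast
    \<comment> \<open>On \<open>C\<close> the function \<open>g\<close> is within
      \<open>e < 1\<close> of \<open>F\<close>, hence below 2 in absolute value and unchanged by the
      truncation.\<close>
    define trunc where "trunc s = max (-2) (min 2 s)" for s :: real
    have cont_trunc: "continuous_on {-B..B} trunc"
      unfolding trunc_def by (intro continuous_intros)
    obtain p where p: "real_polynomial_function p" "\<And>s. s \<in> {-B..B} \<Longrightarrow> \<bar>trunc s - p s\<bar> < e"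
      using Stone_Weierstrass_real_polynomial_function[OF compact_Icc cont_trunc e(1)] by blast
    define h where "h x = p (g x)" for x
    have hA: "h \<in> A"
      unfolding h_def by (intro polynomial_closure[OF p(1) g(1)] Aconst Aadd Amult)
    have close: "\<bar>trunc (g x) - h x\<bar> < e" for x
      using p(2)[of "g x"] B[of x] by (simp add: h_def abs_le_iff)
    \<comment> \<open>On \<open>C\<close> two errors \<open>e\<close> add up. Elsewhere
      \<open>F\<close> contributes at most 1 and \<open>h\<close> at most
      \<open>2 + e\<close>.\<close>
    have dist: "\<bar>F x - h x\<bar> \<le> 2 * e + 4 * indicator (- C) x" for x
    proof (cases "x \<in> C")
      case True
      have "trunc (g x) = g x"
        using g(2)[OF True] F(2)[of x] e by (auto simp: trunc_def abs_le_iff abs_less_iff)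
      then show ?thesis using close[of x] g(2)[OF True] True by (simp add: abs_less_iff abs_le_iff)
    next
      case False
      have "\<bar>trunc (g x)\<bar> \<le> 2" by (auto simp: trunc_def)
      then show ?thesis using close[of x] F(2)[of x] False e by (simp add: abs_less_iff abs_le_iff)
    qed
    \<comment> \<open>The bound is \<open>2 * e\<close> plus 4 times the mass, at most
      \<open>e\<close>, outside \<open>C\<close>.\<close>
    have est: "\<bar>(\<integral>x. F x \<partial>M) - (\<integral>x. h x \<partial>M)\<bar> \<le> 6 * e"
      if M: "prob_space M" "sets M = sets borel" "integrable M F" "integrable M h" "measure M (- C) \<le> e" for M
    proof -
      interpret M: prob_space M by fact
      have "- C \<inter> space M = - C" using sets_eq_imp_space_eq[OF M(2)] by simp
      moreover have "integrable M (\<lambda>x. indicator (- C) x :: real)"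
        using M by (auto intro!: M.integrable_const_bound[where B = 1])
      moreover have "\<bar>(\<integral>x. F x \<partial>M) - (\<integral>x. h x \<partial>M)\<bar> = \<bar>\<integral>x. F x - h x \<partial>M\<bar>"
        using M by simp
      moreover have "\<dots> \<le> (\<integral>x. \<bar>F x - h x\<bar> \<partial>M)"
        by (rule integral_abs_bound)
      moreover have "\<dots> \<le> (\<integral>x. 2 * e + 4 * indicator (- C) x \<partial>M)"
        using M dist \<open>integrable M (\<lambda>x. indicator (- C) x :: real)\<close>
        by (intro integral_mono Bochner_Integration.integrable_add integrable_abs Bochner_Integration.integrable_diff
            integrable_mult_right) auto
      ultimately show ?thesis using M by (simp add: M.prob_space)
    qed
    obtain B' where "\<And>x. \<bar>h x\<bar> \<le> B'" using A(2)[OF hA] by blast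
    then have "\<bar>(\<integral>x. F x \<partial>G) - (\<integral>x. h x \<partial>G)\<bar> \<le> 6 * e" "\<bar>(\<integral>x. F x \<partial>H) - (\<integral>x. h x \<partial>H)\<bar> \<le> 6 * e"
      using int[OF F] int[OF A(1)[OF hA]] CG CH GH by (auto intro!: est)
    then show ?thesis using A(3)[OF hA] by linarith
  qed
  have "\<bar>(\<integral>x. F x \<partial>G) - (\<integral>x. F x \<partial>H)\<bar> \<le> 0"
  proof (rule field_le_epsilon)
    fix e :: real assume e: "e > 0"
    \<comment> \<open>The cap at 1/2 meets the requirement \<open>e < 1\<close> of
      \<open>approx\<close>.\<close>
    define e' where "e' = min (e / 12) (1 / 2)"
    have "0 < e'" "e' < 1" "12 * e' \<le> e" using e by (auto simp: e'_def min_def)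
    then show "\<bar>(\<integral>x. F x \<partial>G) - (\<integral>x. F x \<partial>H)\<bar> \<le> 0 + e" using approx[of e'] by linarith
  qed
  then show "(\<integral>x. F x \<partial>G) = (\<integral>x. F x \<partial>H)" by simp
qed

section \<open>Kernels on Polish spaces\<close>

locale psd_kernel_on_polish =
  fixes K :: "'a::polish_space \<Rightarrow> 'a \<Rightarrow> real"
  assumes cont: "continuous_on UNIV (\<lambda>(x, y). K x y)"
    and sym: "K x y = K y x"
    and psd: "psd_kernel K"
    and inj: "inj (\<lambda>x. \<lambda>y. K y x)"
begin

lemma psd_points: "psd_matrix n (\<lambda>i j. K (x i) (x j))"
  using psd by (simp add: psd_kernel_def)

lemma continuous_kernel:
  "continuous_on UNIV f \<Longrightarrow> continuous_on UNIV g \<Longrightarrow> continuous_on UNIV (\<lambda>z. K (f z) (g z))"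
  using continuous_on_compose2[OF cont, of UNIV "\<lambda>z. (f z, g z)"]
  by (auto intro: continuous_on_Pair)

text \<open>This says that \<open>w\<close> is a continuous element of the reproducing kernel Hilbert space of
  \<open>K\<close> whose squared norm is at most \<open>m\<close>.\<close>

definition rkhs_le :: "('a \<Rightarrow> real) \<Rightarrow> real \<Rightarrow> bool" where
  "rkhs_le w m \<longleftrightarrow> continuous_on UNIV w \<and> 0 \<le> m \<and>
    (\<forall>(n::nat) x c. (\<Sum>i<n. c i * w (x i))\<^sup>2 \<le> m * (\<Sum>i<n. \<Sum>j<n. c i * K (x i) (x j) * c j))"

lemma rkhs_leD:
  assumes "rkhs_le w m"
  shows "continuous_on UNIV w" "0 \<le> m"
    "(\<Sum>i<(n::nat). c i * w (x i))\<^sup>2 \<le> m * (\<Sum>i<n. \<Sum>j<n. c i * K (x i) (x j) * c j)"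
  using assms unfolding rkhs_le_def by auto

text \<open>Cauchy--Schwarz for the feature vector of \<open>y\<close>: adjoin \<open>y\<close> as a
  further point with free weight \<open>b\<close> and take the discriminant.\<close>

lemma rkhs_section: "rkhs_le (\<lambda>x. K x y) (K y y)"
proof -
  have "(\<Sum>i<n. c i * K (x i) y)\<^sup>2 \<le> (\<Sum>i<n. \<Sum>j<n. c i * K (x i) (x j) * c j) * K y y" for n :: nat and x c
  proof (rule quadratic_nonneg_imp_le)
    fix b
    define x' c' where "x' = x(n := y)" and "c' = c(n := b)"
    have "0 \<le> (\<Sum>i<Suc n. \<Sum>j<Suc n. c' i * K (x' i) (x' j) * c' j)"
      by (rule psd_matrixD[OF psd_points])
    also have "\<dots> = (\<Sum>i<n. \<Sum>j<n. c' i * K (x' i) (x' j) * c' j)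
        + 2 * c' n * (\<Sum>i<n. c' i * K (x' i) (x' n)) + (c' n)\<^sup>2 * K (x' n) (x' n)"
      by (rule sum_sum_bordered) (rule sym)
    also have "\<dots> = (\<Sum>i<n. \<Sum>j<n. c i * K (x i) (x j) * c j) + 2 * b * (\<Sum>i<n. c i * K (x i) y) + b\<^sup>2 * K y y"
      by (simp add: x'_def c'_def)
    finally show "0 \<le> (\<Sum>i<n. \<Sum>j<n. c i * K (x i) (x j) * c j) + 2 * b * (\<Sum>i<n. c i * K (x i) y) + b\<^sup>2 * K y y" .
  qed
  moreover have "0 \<le> K y y"
    using psd_matrixD[OF psd_points[where n = "Suc 0" and x = "\<lambda>_. y"], where c = "\<lambda>_. 1"] by simp
  ultimately show ?thesis
    unfolding rkhs_le_def by (auto intro!: continuous_kernel continuous_intros simp: mult.commute)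
qed

lemma rkhs_scale:
  assumes "rkhs_le w m"
  shows "rkhs_le (\<lambda>x. a * w x) (a\<^sup>2 * m)"
proof -
  have "(\<Sum>i<n. c i * (a * w (x i)))\<^sup>2 \<le> a\<^sup>2 * m * (\<Sum>i<n. \<Sum>j<n. c i * K (x i) (x j) * c j)" for n :: nat and x c
  proof -
    have "(\<Sum>i<n. c i * (a * w (x i))) = a * (\<Sum>i<n. c i * w (x i))"
      by (simp add: sum_distrib_left mult_ac)
    then show ?thesis
      using mult_left_mono[OF rkhs_leD(3)[OF assms, where n = n and c = c and x = x], of "a\<^sup>2"]
      by (simp add: power_mult_distrib mult.assoc)
  qed
  then show ?thesis
    using rkhs_leD(1,2)[OF assms] unfolding rkhs_le_def by (auto intro!: continuous_intros)
qed

text \<open>The factor 2 comes from the bound of \<open>(p + q)\<^sup>2\<close> by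
  \<open>2 * p\<^sup>2 + 2 * q\<^sup>2\<close>; a cruder norm bound than the triangle inequality is
  enough.\<close>

lemma rkhs_add:
  assumes "rkhs_le w m" "rkhs_le w' m'"
  shows "rkhs_le (\<lambda>x. w x + w' x) (2 * (m + m'))"
proof -
  have "(\<Sum>i<n. c i * (w (x i) + w' (x i)))\<^sup>2
      \<le> 2 * (m + m') * (\<Sum>i<n. \<Sum>j<n. c i * K (x i) (x j) * c j)" for n :: nat and x c
  proof -
    define p q where "p = (\<Sum>i<n. c i * w (x i))" and "q = (\<Sum>i<n. c i * w' (x i))"
    have "(\<Sum>i<n. c i * (w (x i) + w' (x i))) = p + q"
      by (simp add: p_def q_def distrib_left sum.distrib)
    moreover have "(p + q)\<^sup>2 \<le> 2 * p\<^sup>2 + 2 * q\<^sup>2"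
      using zero_le_power2[of "p - q"] by (simp add: power2_eq_square algebra_simps)
    ultimately show ?thesis
      using rkhs_leD(3)[OF assms(1), where n = n and c = c and x = x]
        rkhs_leD(3)[OF assms(2), where n = n and c = c and x = x]
      by (simp add: p_def q_def algebra_simps)
  qed
  then show ?thesis
    using rkhs_leD(1,2)[OF assms(1)] rkhs_leD(1,2)[OF assms(2)]
    unfolding rkhs_le_def by (auto intro!: continuous_intros)
qed

text \<open>This adjoins \<open>w\<close> to the feature vectors of the points, with
  \<open>m\<close> in place of its squared norm.\<close>

lemma psd_bordered_kernel:
  assumes w: "rkhs_le w m"
  shows "psd_matrix (Suc n) (\<lambda>i j. if i < n then if j < n then K (x i) (x j) else w (x i)
      else if j < n then w (x j) else m)" (is "psd_matrix _ ?A")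
  unfolding psd_matrix_def
proof (intro conjI allI impI)
  show "?A i j = ?A j i" for i j by (auto simp: sym)
  fix c :: "nat \<Rightarrow> real"
  have "(\<Sum>i<Suc n. \<Sum>j<Suc n. c i * ?A i j * c j)
      = (\<Sum>i<n. \<Sum>j<n. c i * ?A i j * c j) + 2 * c n * (\<Sum>i<n. c i * ?A i n) + (c n)\<^sup>2 * ?A n n"
    by (rule sum_sum_bordered) simp
  also have "\<dots> = (\<Sum>i<n. \<Sum>j<n. c i * K (x i) (x j) * c j) + 2 * c n * (\<Sum>i<n. c i * w (x i)) + (c n)\<^sup>2 * m"
    by simp
  also have "\<dots> \<ge> 0"
    by (intro quadratic_nonnegI rkhs_leD[OF w] psd_matrixD[OF psd_points])
  finally show "0 \<le> (\<Sum>i<Suc n. \<Sum>j<Suc n. c i * ?A i j * c j)" .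
qed

text \<open>The squared Hilbert space distance between the feature vector of \<open>x\<close> and \<open>w\<close>.\<close>

definition feature_dist :: "('a \<Rightarrow> real) \<Rightarrow> real \<Rightarrow> 'a \<Rightarrow> real" where
  "feature_dist w m x = K x x + m - 2 * w x"

lemma feature_dist_nonneg:
  assumes "rkhs_le w m"
  shows "0 \<le> feature_dist w m x"
  using psd_matrixD[OF psd_bordered_kernel[OF assms, where n = "Suc 0" and x = "\<lambda>_. x"],
      where c = "\<lambda>i. if i = 0 then 1 else -1"]
  by (simp add: feature_dist_def)

lemma kernel_delta_nonneg: "0 \<le> kernel_delta K x y"
  using feature_dist_nonneg[OF rkhs_section] by (simp add: feature_dist_def kernel_delta_def)

text \<open>Gaussians of the bordered matrix are positive semidefinite, and their diagonal is 1,
  whence the last coefficient. The result is the hypothesis of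
  \<open>energy_nonneg_augmented\<close> for \<open>m = 1\<close>.\<close>

lemma gaussian_bordered_nonneg:
  fixes n :: nat
  assumes w: "rkhs_le w m" and t: "0 \<le> t"
  shows "0 \<le> (\<Sum>i<n. \<Sum>j<n. c i * exp (- t * kernel_delta K (x i) (x j)) * c j)
    + 2 * b * (\<Sum>i<n. c i * exp (- t * feature_dist w m (x i))) + b\<^sup>2 * 1"
proof -
  define A where "A = (\<lambda>i j. if i < n then if j < n then K (x i) (x j) else w (x i)
      else if j < n then w (x j) else m)"
  define B where "B i j = exp (- t * (A i i + A j j - 2 * A i j))" for i j
  define c' where "c' = c(n := b)"
  have psdB: "psd_matrix (Suc n) B"
    unfolding B_def A_def by (intro psd_matrix_gaussian psd_bordered_kernel w t)
  have "0 \<le> (\<Sum>i<Suc n. \<Sum>j<Suc n. c' i * B i j * c' j)"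
    by (rule psd_matrixD[OF psdB])
  also have "\<dots> = (\<Sum>i<n. \<Sum>j<n. c' i * B i j * c' j) + 2 * c' n * (\<Sum>i<n. c' i * B i n) + (c' n)\<^sup>2 * B n n"
    by (rule sum_sum_bordered) (simp add: psd_matrix_symD[OF psdB])
  finally show ?thesis
    by (simp add: c'_def B_def A_def kernel_delta_def feature_dist_def)
qed

text \<open>The difference of the two feature vectors has norm 0, so by Cauchy--Schwarz every
  section of \<open>K\<close> agrees at \<open>x\<close> and \<open>y\<close>.\<close>

lemma kernel_delta_zero_imp_eq:
  assumes "kernel_delta K x y = 0"
  shows "x = y"
proof -
  have "K x z = K y z" for z
    using rkhs_leD(3)[OF rkhs_section[of z], where n = "Suc (Suc 0)" and c = "\<lambda>i. if i = 0 then 1 else -1"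
        and x = "\<lambda>i. if i = 0 then x else y"] assms sym[of x y]
    by (simp add: kernel_delta_def)
  then have "(\<lambda>z. K z x) = (\<lambda>z. K z y)" by (auto simp: sym)
  then show ?thesis using inj by (auto dest: injD)
qed

text \<open>For the triangle inequality, a Gram factorization places three given points
  isometrically in a Euclidean space of dimension 3, where Minkowski's inequality applies.\<close>

lemma metric_sqrt_kernel_delta: "Metric_space UNIV (\<lambda>x y. sqrt (kernel_delta K x y))"
proof
  show "0 \<le> sqrt (kernel_delta K x y)" for x y by (simp add: kernel_delta_nonneg)
  show "sqrt (kernel_delta K x y) = sqrt (kernel_delta K y x)" for x y
    by (simp add: kernel_delta_def sym[of x y])
  show "sqrt (kernel_delta K x y) = 0 \<longleftrightarrow> x = y" for x y
    using kernel_delta_zero_imp_eq[of x y] by (auto simp: kernel_delta_def)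
  fix x y z :: 'a
  define p where "p i = (if i = 0 then x else if i = 1 then y else z)" for i :: nat
  obtain L where L: "\<And>i j. i < 3 \<Longrightarrow> j < 3 \<Longrightarrow> K (p i) (p j) = (\<Sum>k<(3::nat). L k i * L k j)"
    by (rule psd_matrix_gram[OF psd_points[of 3 p]]) blast
  have D: "sqrt (kernel_delta K (p i) (p j)) = L2_set (\<lambda>k. L k i - L k j) {..<3}" if "i < 3" "j < 3" for i j
  proof -
    have "kernel_delta K (p i) (p j)
        = (\<Sum>k<3. L k i * L k i) + (\<Sum>k<3. L k j * L k j) - 2 * (\<Sum>k<(3::nat). L k i * L k j)"
      unfolding kernel_delta_def by (simp only: L that)
    also have "\<dots> = (\<Sum>k<3. L k i * L k i + L k j * L k j - 2 * (L k i * L k j))"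
      by (simp only: sum.distrib sum_subtractf sum_distrib_left)
    also have "\<dots> = (\<Sum>k<3. (L k i - L k j)\<^sup>2)"
      by (intro sum.cong refl) (simp add: power2_eq_square algebra_simps)
    finally show ?thesis by (simp only: L2_set_def)
  qed
  have "L2_set (\<lambda>k. L k 0 - L k 2) {..<3} = L2_set (\<lambda>k. (L k 0 - L k 1) + (L k 1 - L k 2)) {..<3}"
    by simp
  also have "\<dots> \<le> L2_set (\<lambda>k. L k 0 - L k 1) {..<3} + L2_set (\<lambda>k. L k 1 - L k 2) {..<3}"
    by (rule L2_set_triangle_ineq)
  finally show "sqrt (kernel_delta K x z) \<le> sqrt (kernel_delta K x y) + sqrt (kernel_delta K y z)"
    using D[of 0 2] D[of 0 1] D[of 1 2] by (simp add: p_def)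
qed

text \<open>The factor with \<open>t > 0\<close> keeps the functions bounded although
  \<open>w\<close> may be unbounded; the constant 1 is therefore inserted separately.\<close>

definition gaussian_monoid :: "('a \<Rightarrow> real) set" where
  "gaussian_monoid = insert (\<lambda>_. 1) {\<lambda>x. exp (- t * K x x + w x) | t w m. 0 < t \<and> rkhs_le w m}"

lemma gaussian_monoidI: "0 < t \<Longrightarrow> rkhs_le w m \<Longrightarrow> (\<lambda>x. exp (- t * K x x + w x)) \<in> gaussian_monoid"
  unfolding gaussian_monoid_def by blast

text \<open>Completing the square with \<open>w\<close> rescaled by \<open>1 / (2 * t)\<close>
  exhibits the exponential as a multiple of a Gaussian centred at an element of the Hilbert
  space.\<close>

lemma gaussian_monoid_cases:
  assumes "f \<in> gaussian_monoid"
  obtains "f = (\<lambda>_. 1)"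
  | t w m where "0 < t" "rkhs_le w m" "f = (\<lambda>x. exp (t * m) * exp (- t * feature_dist w m x))"
proof -
  consider "f = (\<lambda>_. 1)" | t w m where "0 < t" "rkhs_le w m" "f = (\<lambda>x. exp (- t * K x x + w x))"
    using assms unfolding gaussian_monoid_def by auto
  then show ?thesis
  proof cases
    case (2 t w m)
    have "f = (\<lambda>x. exp (t * ((1 / (2 * t))\<^sup>2 * m)) * exp (- t * feature_dist (\<lambda>x. 1 / (2 * t) * w x) ((1 / (2 * t))\<^sup>2 * m) x))"
      unfolding 2(3) using 2(1) by (auto simp: feature_dist_def algebra_simps simp flip: exp_add)
    then show ?thesis using that(2)[OF 2(1) rkhs_scale[OF 2(2)]] by blast
  qed (use that in blast)
qed

lemma gaussian_monoid_mult:
  assumes "f \<in> gaussian_monoid" "g \<in> gaussian_monoid"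
  shows "(\<lambda>x. f x * g x) \<in> gaussian_monoid"
proof (cases "f = (\<lambda>_. 1) \<or> g = (\<lambda>_. 1)")
  case False
  then obtain t w m t' w' m' where
    f: "0 < t" "rkhs_le w m" "f = (\<lambda>x. exp (- t * K x x + w x))" and
    g: "0 < t'" "rkhs_le w' m'" "g = (\<lambda>x. exp (- t' * K x x + w' x))"
    using assms unfolding gaussian_monoid_def by blast
  have "(\<lambda>x. f x * g x) = (\<lambda>x. exp (- (t + t') * K x x + (w x + w' x)))"
    unfolding f g by (simp add: algebra_simps flip: exp_add)
  then show ?thesis
    using gaussian_monoidI[of "t + t'", OF _ rkhs_add[OF f(2) g(2)]] f(1) g(1) by simp
qed (use assms in auto)

lemma gaussian_monoid_separates:
  assumes "x \<noteq> y"
  shows "\<exists>f\<in>gaussian_monoid. f x \<noteq> f y"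
proof (rule ccontr)
  assume "\<not> ?thesis"
  then have eq: "f x = f y" if "f \<in> gaussian_monoid" for f using that by blast
  \<comment> \<open>The choice \<open>w = 0\<close>, obtained by scaling a section by 0, isolates
    the diagonal; sections as \<open>w\<close> then recover \<open>K x z\<close>.\<close>
  have "- K x x = - K y y"
    using eq[OF gaussian_monoidI[of 1, OF _ rkhs_scale[OF rkhs_section[of x], of 0]]] by simp
  moreover have "- K x x + K x z = - K y y + K y z" for z
    using eq[OF gaussian_monoidI[of 1, OF _ rkhs_section[of z]]] by simp
  ultimately have "K x z = K y z" for z by simp
  then have "(\<lambda>z. K z x) = (\<lambda>z. K z y)" by (auto simp: sym)
  then show False using inj assms by (auto dest: injD)
qed

lemma continuous_feature_dist:
  assumes "rkhs_le w m"
  shows "continuous_on UNIV (feature_dist w m)"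
  unfolding feature_dist_def [abs_def]
  by (intro continuous_intros continuous_kernel rkhs_leD(1)[OF assms])

lemma strong_negative_type_sqrt_kernel_delta:
  "strong_negative_type (\<lambda>x y. sqrt (kernel_delta K x y))"
proof -
  define \<rho> where "\<rho> x y = sqrt (kernel_delta K x y)" for x y
  have metric: "Metric_space UNIV \<rho>"
    using metric_sqrt_kernel_delta by (simp add: \<rho>_def [abs_def])
  have gauss: "exp (- (u * \<rho> x y)\<^sup>2) = exp (- u\<^sup>2 * kernel_delta K x y)" for u x y
    by (simp add: \<rho>_def power_mult_distrib kernel_delta_nonneg)
  have cont_delta: "continuous_on UNIV (\<lambda>z. kernel_delta K (fst z) (snd z))"
    unfolding kernel_delta_def by (intro continuous_intros continuous_kernel)
  have meas: "f \<in> borel_measurable (borel \<Otimes>\<^sub>M borel)" if "continuous_on UNIV f" for f :: "'a \<times> 'a \<Rightarrow> real"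
    unfolding borel_prod by (rule borel_measurable_continuous_onI[OF that])
  have \<rho>_meas: "(\<lambda>z. \<rho> (fst z) (snd z)) \<in> borel_measurable (borel \<Otimes>\<^sub>M borel)"
    unfolding \<rho>_def by (intro meas continuous_on_real_sqrt cont_delta)
  have main: "metric_discrepancy \<rho> G H \<le> 0 \<and> (metric_discrepancy \<rho> G H = 0 \<longrightarrow> G = H)"
    if GH: "borel_prob G" "borel_prob H" and mom: "finite_first_moment \<rho> G" "finite_first_moment \<rho> H" for G H
  proof -
    have GH': "prob_space G" "prob_space H" "sets G = sets borel" "sets H = sets borel"
      using GH by (auto simp: borel_prob_def)
    interpret prob_pair G H borel by (rule prob_pair.intro[OF GH'])
    have D: "metric_discrepancy \<rho> G H = energy \<rho> G H"
      by (rule metric_discrepancy_eq_energy[OF \<rho>_meas metric mom])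
    have aug: "0 \<le> energy (\<lambda>x y. exp (- (u * \<rho> x y)\<^sup>2)) G H
        + 2 * b * ((\<integral>x. exp (- u\<^sup>2 * feature_dist w m x) \<partial>G) - (\<integral>x. exp (- u\<^sup>2 * feature_dist w m x) \<partial>H)) + b\<^sup>2 * 1"
      if w: "rkhs_le w m" for u w m b
      unfolding gauss
    proof (rule energy_nonneg_augmented[OF GH', where B = 1 and U = 1])
      show "(\<lambda>p. exp (- u\<^sup>2 * kernel_delta K (fst p) (snd p))) \<in> borel_measurable (borel \<Otimes>\<^sub>M borel)"
        by (intro meas continuous_intros cont_delta)
      show "(\<lambda>x. exp (- u\<^sup>2 * feature_dist w m x)) \<in> borel_measurable borel"
        by (intro borel_measurable_continuous_onI continuous_intros continuous_feature_dist w)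
    qed (use kernel_delta_nonneg feature_dist_nonneg[OF w] gaussian_bordered_nonneg[OF w] in auto)
    \<comment> \<open>Weight \<open>b = 0\<close> removes the adjoined vector, so any section of
      \<open>K\<close> serves as \<open>w\<close>.\<close>
    have pos: "0 \<le> energy (\<lambda>x y. exp (- (u * \<rho> x y)\<^sup>2)) G H" for u
      using aug[OF rkhs_section, of u 0] by simp
    have \<rho>_nonneg: "0 \<le> \<rho> x y" for x y by (simp add: \<rho>_def kernel_delta_nonneg)
    note int = integrable_metric_pairs[OF \<rho>_meas metric mom]
    have "energy \<rho> G H \<le> 0"
      by (rule energy_nonpos[OF \<rho>_meas \<rho>_nonneg int pos])
    moreover have "G = H" if "energy \<rho> G H = 0"
    proof (rule measure_eqI_separating_monoid[OF GH', where S = gaussian_monoid])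
      have zero: "energy (\<lambda>x y. exp (- (u * \<rho> x y)\<^sup>2)) G H = 0" for u
        by (rule energy_zero_imp[OF \<rho>_meas \<rho>_nonneg int pos that])
      have integrals: "(\<integral>x. exp (- t * feature_dist w m x) \<partial>G) = (\<integral>x. exp (- t * feature_dist w m x) \<partial>H)"
        if w: "rkhs_le w m" and t: "0 < t" for t w m
      proof -
        \<comment> \<open>With \<open>u = sqrt t\<close> and zero energy, the quadratic in
          \<open>b\<close> has constant term 0 and leading coefficient 1, so its discriminant forces
          the linear coefficient to vanish.\<close>
        have "((\<integral>x. exp (- t * feature_dist w m x) \<partial>G) - (\<integral>x. exp (- t * feature_dist w m x) \<partial>H))\<^sup>2 \<le> 0 * 1"
          using aug[OF w, of "sqrt t"] t unfolding zero
          by (intro quadratic_nonneg_imp_le) simp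
        then show ?thesis by simp
      qed
      fix f assume f: "f \<in> gaussian_monoid"
      show "continuous_on UNIV f"
        using f by (cases rule: gaussian_monoid_cases) (auto intro!: continuous_intros continuous_feature_dist)
      show "\<exists>B. \<forall>x. \<bar>f x\<bar> \<le> B"
        using f
      proof (cases rule: gaussian_monoid_cases)
        case (2 t w m)
        then have "\<bar>f x\<bar> \<le> exp (t * m)" for x
          using feature_dist_nonneg[OF 2(2), of x] by (simp add: abs_mult)
        then show ?thesis by blast
      qed auto
      show "(\<integral>x. f x \<partial>G) = (\<integral>x. f x \<partial>H)"
        using f
      proof (cases rule: gaussian_monoid_cases)
        case 1
        then show ?thesis
          using GH'(1,2)[THEN prob_space.prob_space] by simp
      next
        case (2 t w m)
        then show ?thesis using integrals[OF 2(2,1)] by simp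
      qed
    next
      show "(\<lambda>_. 1) \<in> gaussian_monoid" by (simp add: gaussian_monoid_def)
      show "(\<lambda>x. f x * g x) \<in> gaussian_monoid" if "f \<in> gaussian_monoid" "g \<in> gaussian_monoid" for f g
        using that by (rule gaussian_monoid_mult)
      show "\<exists>f\<in>gaussian_monoid. f x \<noteq> f y" if "x \<noteq> y" for x y
        using that by (rule gaussian_monoid_separates)
    qed
    ultimately show ?thesis unfolding D by blast
  qed
  \<comment> \<open>The converse in the equality case: \<open>G - G\<close> integrates every
    function to 0.\<close>
  have "metric_discrepancy \<rho> G G = 0" for G
    by (simp add: metric_discrepancy_def diff_integral_def)
  then have "strong_negative_type \<rho>"
    unfolding strong_negative_type_def negative_type_def using main by blast
  then show ?thesis by (simp add: \<rho>_def [abs_def])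
qed

end

theorem theorem4p3:
  fixes K :: "'a::polish_space \<Rightarrow> 'a \<Rightarrow> real"
  assumes "continuous_on UNIV (\<lambda>(x, y). K x y)"
    and "\<And>x y. K x y = K y x"
    and "psd_kernel K"
    and "inj (\<lambda>x. \<lambda>y. K y x)"
  shows "Metric_space UNIV (\<lambda>x y. sqrt (kernel_delta K x y)) \<and>
         strong_negative_type (\<lambda>x y. sqrt (kernel_delta K x y))"
proof -
  interpret psd_kernel_on_polish K by unfold_locales (fact assms)+
  show ?thesis
    using metric_sqrt_kernel_delta strong_negative_type_sqrt_kernel_delta by blast
qed

end
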